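(* Let $(W,S)$ be a Coxeter system, let $r,t\in T$ with $r\ne t$ and let $W'=\langle r,t\rangle$ be the dihedral reflection subgroup generated by $r$ and $t$. Let $p_r$ be an $r$-prefix and $p_t$ a $t$-prefix. Write $\Phi_{W'}(p_r)=\Phi(p_r)\cap\Phi_{W'}$ and $\Phi_{W'}(p_t)=\Phi(p_t)\cap\Phi_{W'}$. (1) If $|\Phi_{W'}(p_r)|=|\Phi_{W'}(p_t)|=1$, then $\Delta_{W'}=\{\alpha_r,\alpha_t\}$ and $\chi(W')=\{r,t\}$. (2) If $|\Phi_{W'}(p_r)|>1$ (resp. $|\Phi_{W'}(p_t)|>1$), then $\Delta_{W'}=\{\alpha_1,\alpha_2\}$ and $\chi(W')=\{s_1,s_2\}$ with $s_i=s_{\alpha_i}$, where $\alpha_1$ is the unique root with the smallest depth in $\Phi(p_r)\cap\Phi_{W'}$ (resp. $\Phi(p_t)\cap\Phi_{W'}$) and $s_1(\alpha_2)$ is the unique root with smallest depth in $(\Phi(p_r)\cap\Phi_{W'})\setminus\{\alpha_1\}$ (resp. $(\Phi(p_t)\cap\Phi_{W'})\setminus\{\alpha_1\}$).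
   Context: $(W,S)$ is a Coxeter system with $S$ finite, length function $\ell$, and set of reflections $T=\bigcup_{w\in W}wSw^{-1}$. Geometric representation: $V$ is a finite-dimensional real vector space with a symmetric bilinear form $B$, and $\Delta=\{\alpha_s\mid s\in S\}\subset V$ is such that: if $\sum a_s\alpha_s=0$ with all $a_s\ge 0$ then all $a_s=0$; $B(\alpha_s,\alpha_s)=1$; for $s\ne t$, $B(\alpha_s,\alpha_t)=-\cos(\pi/m_{st})$ if the order $m_{st}$ of $st$ is finite and $B(\alpha_s,\alpha_t)\le -1$ if $m_{st}=\infty$. $W$ acts faithfully on $V$ by $s(v)=v-2B(\alpha_s,v)\alpha_s$. $\Phi=W(\Delta)$ is the root system, $\Phi^+=\Phi\cap\operatorname{cone}(\Delta)$, $\Phi^-=-\Phi^+$. For $t\in T$, $\alpha_t\in\Phi^+$ is the unique positive root whose associated reflection is $t$; $s_\alpha\in T$ is the reflection of a root $\alpha$. The inversion set of $w$ is $\Phi(w)=\{\alpha\in\Phi^+\mid w^{-1}(\alpha)\in\Phi^-\}$. The depth of $\beta\in\Phi^+$ is $\operatorname{dp}(\beta)=\min\{\ell(w)\mid w\in W,\ w(\beta)\in\Delta\}$. For $t\in T$, a $t$-prefix is an element $p\in W$, $p\neq e$, such that for any reduced word $p=s_1\cdots s_{k+1}$ the word $s_1\cdots s_ks_{k+1}s_k\cdots s_1$ is a (palindromic) reduced word for $t$. For a reflection subgroup $W'$: $\Phi_{W'}=\{\alpha\in\Phi\mid s_\alpha\in W'\}$, $\Delta_{W'}=\{\alpha\in\Phi^+\mid\Phi(s_\alpha)\cap\Phi_{W'}=\{\alpha\}\}$,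 and $\chi(W')=\{s_\alpha\mid\alpha\in\Delta_{W'}\}$ is the set of canonical generators. By Dyer, $(W',\chi(W'))$ is a Coxeter system with root system $\Phi_{W'}$ and simple system $\Delta_{W'}$; it has two canonical generators when $W'$ is generated by two distinct reflections. *)

theory Defs
  imports "HOL-Algebra.Group_Action" "HOL-Algebra.Multiplicative_Group" "HOL-Analysis.Linear_Algebra"
begin

locale involution_generated = group W for W :: "('w, 'm) monoid_scheme" (structure) +
  fixes S :: "'w set"
  assumes finite_S: "finite S"
    and S_subset: "S \<subseteq> carrier W"
    and one_notin_S: "\<one> \<notin> S"
    and S_involution: "s \<in> S \<Longrightarrow> s \<otimes> s = \<one>"
    and S_generates: "generate W S = carrier W"
begin

definition word_prod :: "'w list \<Rightarrow> 'w" where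
  "word_prod ws = foldr (\<otimes>) ws \<one>"

text \<open>Deletion of one relator \<open>(st)\<^sup>m\<close>, where \<open>m\<close> is the order of \<open>st\<close>. The case \<open>s = t\<close>
  (with \<open>m = 1\<close>) deletes \<open>ss\<close>. The library sets \<open>ord x = 0\<close> if \<open>x\<close> has infinite
  order; the relator is then the empty word, so that no relation is imposed.\<close>

inductive relator_step :: "'w list \<Rightarrow> 'w list \<Rightarrow> bool" where
  "\<lbrakk>u \<in> lists S; v \<in> lists S; s \<in> S; t \<in> S\<rbrakk>
    \<Longrightarrow> relator_step (u @ concat (replicate (ord (s \<otimes> t)) [s, t]) @ v) (u @ v)"

end

text \<open>The assumption \<open>presentation\<close> says that \<open>W\<close> is presented by the generators \<open>S\<close> and the
  relations \<open>(st)\<^sup>m = 1\<close>. As each \<open>s \<in> S\<close> is its own inverse by the relation \<open>ss = 1\<close>,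
  words without formal inverses suffice.\<close>

locale coxeter_system = involution_generated W S
  for W :: "('w, 'm) monoid_scheme" (structure) and S :: "'w set" +
  assumes presentation:
    "\<lbrakk>u \<in> lists S; v \<in> lists S; word_prod u = word_prod v\<rbrakk> \<Longrightarrow> equivclp relator_step u v"
begin

definition len :: "'w \<Rightarrow> nat" where
  "len w = (LEAST n. \<exists>ws \<in> lists S. word_prod ws = w \<and> length ws = n)"

definition reduced_word :: "'w list \<Rightarrow> 'w \<Rightarrow> bool" where
  "reduced_word ws w \<longleftrightarrow> ws \<in> lists S \<and> word_prod ws = w \<and> length ws = len w"

definition reflections :: "'w set" where
  "reflections = {w \<otimes> s \<otimes> inv w | w s. w \<in> carrier W \<and> s \<in> S}"

definition reflection_prefix :: "'w \<Rightarrow> 'w \<Rightarrow> bool" where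
  "reflection_prefix t p \<longleftrightarrow> p \<in> carrier W \<and> p \<noteq> \<one> \<and>
     (\<forall>ws. reduced_word ws p \<longrightarrow> reduced_word (ws @ rev (butlast ws)) t)"

end

text \<open>\<open>act\<close> is uniquely determined on \<open>carrier W\<close> by \<open>act_simple\<close> and the homomorphism property;
  linearity of \<open>act w\<close> follows from \<open>act_simple\<close>, as \<open>S\<close> generates \<open>W\<close>.\<close>

locale geometric_representation = coxeter_system W S
  for W :: "('w, 'm) monoid_scheme" (structure) and S :: "'w set" +
  fixes B :: "'v::real_vector \<Rightarrow> 'v \<Rightarrow> real"
    and \<alpha> :: "'w \<Rightarrow> 'v"
    and act :: "'w \<Rightarrow> 'v \<Rightarrow> 'v"
  assumes finite_dimensional: "\<exists>E :: 'v set. finite E \<and> span E = UNIV"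
    and B_bilinear: "bilinear B"
    and B_sym: "B x y = B y x"
    and positively_independent:
      "\<lbrakk>\<And>s. s \<in> S \<Longrightarrow> 0 \<le> a s; (\<Sum>s\<in>S. a s *\<^sub>R \<alpha> s) = 0; s \<in> S\<rbrakk> \<Longrightarrow> a s = 0"
    and B_diag: "s \<in> S \<Longrightarrow> B (\<alpha> s) (\<alpha> s) = 1"
    and B_finite_order:
      "\<lbrakk>s \<in> S; t \<in> S; s \<noteq> t; ord (s \<otimes> t) \<noteq> 0\<rbrakk>
        \<Longrightarrow> B (\<alpha> s) (\<alpha> t) = - cos (pi / real (ord (s \<otimes> t)))"
    and B_infinite_order:
      "\<lbrakk>s \<in> S; t \<in> S; s \<noteq> t; ord (s \<otimes> t) = 0\<rbrakk> \<Longrightarrow> B (\<alpha> s) (\<alpha> t) \<le> -1"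
    and faithful_act: "faithful_action W (UNIV :: 'v set) act"
    and act_simple: "s \<in> S \<Longrightarrow> act s v = v - (2 * B (\<alpha> s) v) *\<^sub>R \<alpha> s"
begin

definition roots :: "'v set" where
  "roots = {act w (\<alpha> s) | w s. w \<in> carrier W \<and> s \<in> S}"

definition simple_cone :: "'v set" where
  "simple_cone = {\<Sum>s\<in>S. a s *\<^sub>R \<alpha> s | a. \<forall>s\<in>S. 0 \<le> a s}"

definition pos_roots :: "'v set" where
  "pos_roots = roots \<inter> simple_cone"

definition neg_roots :: "'v set" where
  "neg_roots = uminus ` pos_roots"

text \<open>The reflection is determined by its action on the space, since the action is faithful.\<close>

definition root_reflection :: "'v \<Rightarrow> 'w" where
  "root_reflection \<beta> = (THE t. t \<in> reflections \<and> (\<forall>v. act t v = v - (2 * B \<beta> v) *\<^sub>R \<beta>))"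

definition reflection_root :: "'w \<Rightarrow> 'v" where
  "reflection_root t = (THE \<beta>. \<beta> \<in> pos_roots \<and> root_reflection \<beta> = t)"

definition inversion_set :: "'w \<Rightarrow> 'v set" where
  "inversion_set w = {\<beta> \<in> pos_roots. act (inv w) \<beta> \<in> neg_roots}"

definition depth :: "'v \<Rightarrow> nat" where
  "depth \<beta> = (LEAST n. \<exists>w \<in> carrier W. len w = n \<and> act w \<beta> \<in> \<alpha> ` S)"

definition unique_min_depth :: "'v set \<Rightarrow> 'v \<Rightarrow> bool" where
  "unique_min_depth X \<beta> \<longleftrightarrow> \<beta> \<in> X \<and> (\<forall>\<gamma> \<in> X - {\<beta>}. depth \<beta> < depth \<gamma>)"

definition subgroup_roots :: "'w set \<Rightarrow> 'v set" where
  "subgroup_roots W' = {\<beta> \<in> roots. root_reflection \<beta> \<in> W'}"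

definition canonical_roots :: "'w set \<Rightarrow> 'v set" where
  "canonical_roots W' =
     {\<beta> \<in> pos_roots. inversion_set (root_reflection \<beta>) \<inter> subgroup_roots W' = {\<beta>}}"

definition canonical_generators :: "'w set \<Rightarrow> 'w set" where
  "canonical_generators W' = root_reflection ` canonical_roots W'"

end

end

theory Submission
  imports Defs
begin

text \<open>Every root is positive or negative, so lengths and depths are read off from the action: if
  \<open>w\<close> makes the positive root \<open>d\<close> negative, then \<open>dp(d) < len w\<close> and \<open>len (w s\<^sub>d) < len w\<close>.
  In a dihedral reflection subgroup, a root \<open>a\<close> of minimal depth and a root \<open>b\<close> of minimal depth among
  the remaining positive ones are canonical, because a shortest \<open>w\<close> taking \<open>c\<close> to a simple root
  inverts one of \<open>d\<close>, \<open>- s\<^sub>c d\<close> for each inversion \<open>d \<noteq> c\<close> of \<open>s\<^sub>c\<close>. As \<open>B(a, b) \<le> 0\<close> and the roots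
  of the subgroup lie in a plane, \<open>a\<close> and \<open>b\<close> are the only canonical roots, and all positive roots
  of the subgroup lie in their cone.

  For a \<open>t\<close>-prefix \<open>p\<close>, the inversions of \<open>t\<close> are \<open>\<alpha>\<^sub>t\<close> and the pairs \<open>d\<close>, \<open>- t d\<close> with
  \<open>d \<noteq> \<alpha>\<^sub>t\<close> an inversion of \<open>p\<close>, the root \<open>- t d\<close> not being one. Hence \<open>\<alpha>\<^sub>t\<close> is canonical if \<open>p\<close> has
  one inversion in the subgroup. Otherwise \<open>p\<close> inverts exactly one of \<open>a\<close>, \<open>b\<close>, say \<open>a\<close>, and inverts
  \<open>s\<^sub>b a\<close> only if \<open>s\<^sub>b a = s\<^sub>a b\<close>; all positive roots of the subgroup except \<open>a\<close>, \<open>b\<close>,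
  \<open>s\<^sub>a b\<close> and \<open>s\<^sub>b a\<close> are deeper than \<open>s\<^sub>a b\<close>, and all except \<open>a\<close> and \<open>b\<close> are deeper than both.\<close>

subsection \<open>Words and length\<close>

context involution_generated
begin

lemma S_carrier: "s \<in> S \<Longrightarrow> s \<in> carrier W"
  using S_subset by blast

lemma S_inv: "s \<in> S \<Longrightarrow> inv s = s"
  by (simp add: S_carrier S_involution inv_equality)

lemma word_prod_simps [simp]:
  "word_prod [] = \<one>" "word_prod (s # ws) = s \<otimes> word_prod ws"
  by (simp_all add: word_prod_def)

lemma word_prod_closed [simp]: "ws \<in> lists S \<Longrightarrow> word_prod ws \<in> carrier W"
  by (induction ws) (auto simp: S_carrier)

lemma word_prod_append:
  "us \<in> lists S \<Longrightarrow> vs \<in> lists S \<Longrightarrow> word_prod (us @ vs) = word_prod us \<otimes> word_prod vs"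
  by (induction us) (auto simp: S_carrier m_assoc)

lemma inv_word_prod: "ws \<in> lists S \<Longrightarrow> inv (word_prod ws) = word_prod (rev ws)"
  by (induction ws)
    (auto simp: S_carrier S_inv inv_mult_group word_prod_append in_lists_conv_set)

lemma ex_word:
  assumes "w \<in> carrier W"
  shows "\<exists>ws \<in> lists S. word_prod ws = w"
proof -
  from assms have "w \<in> generate W S" by (simp add: S_generates)
  then show ?thesis
  proof (induction rule: generate.induct)
    case one
    then show ?case by (intro bexI[of _ "[]"]) auto
  next
    case (incl h)
    then show ?case by (intro bexI[of _ "[h]"]) (auto simp: S_carrier)
  next
    case (inv h)
    then show ?case by (intro bexI[of _ "[h]"]) (auto simp: S_carrier S_inv)
  next
    case (eng h1 h2)
    then obtain us vs where "us \<in> lists S" "vs \<in> lists S" "word_prod us = h1" "word_prod vs = h2"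
      by blast
    then show ?case by (intro bexI[of _ "us @ vs"]) (auto simp: word_prod_append)
  qed
qed

lemma carrier_induct [consumes 1, case_names one mult]:
  assumes "w \<in> carrier W" and "P \<one>"
    and "\<And>s w. s \<in> S \<Longrightarrow> w \<in> carrier W \<Longrightarrow> P w \<Longrightarrow> P (s \<otimes> w)"
  shows "P w"
proof -
  obtain ws where ws: "ws \<in> lists S" "word_prod ws = w" using ex_word[OF assms(1)] by blast
  have "P (word_prod ws)" using ws(1) by (induction ws) (auto intro!: assms(2,3) simp: in_lists_conv_set)
  then show ?thesis using ws(2) by simp
qed

section \<open>Products of two generators and the braid relation\<close>

lemma ord_ne_1:
  assumes "a \<in> S" "b \<in> S" "a \<noteq> b"
  shows "ord (a \<otimes> b) \<noteq> 1"
proof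
  have c: "a \<in> carrier W" "b \<in> carrier W" using assms S_carrier by auto
  assume "ord (a \<otimes> b) = 1"
  then have "a \<otimes> b = \<one>" using c ord_eq_1[of "a \<otimes> b"] by simp
  then have "a = b" using c S_inv[OF assms(2)] inv_equality[of a b] by simp
  then show False using assms by simp
qed

text \<open>An alternating word with \<open>n\<close> letters whose rightmost letter is
  \<open>b\<close>. It grows on the left, so that each further letter acts on a vector already
  computed.\<close>

fun alt_prod :: "'w \<Rightarrow> 'w \<Rightarrow> nat \<Rightarrow> 'w" where
  "alt_prod a b 0 = \<one>"
| "alt_prod a b (Suc n) = (if even n then b else a) \<otimes> alt_prod a b n"

lemma alt_prod_closed: "a \<in> carrier W \<Longrightarrow> b \<in> carrier W \<Longrightarrow> alt_prod a b n \<in> carrier W"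
  by (induction n) auto

lemma alt_prod_Suc_right:
  "a \<in> carrier W \<Longrightarrow> b \<in> carrier W \<Longrightarrow> alt_prod a b (Suc n) = alt_prod b a n \<otimes> b"
  by (induction n) (auto simp: alt_prod_closed m_assoc)

lemma mult_pow_swap:
  assumes "a \<in> carrier W" "b \<in> carrier W"
  shows "a \<otimes> (b \<otimes> a) [^] (n::nat) = (a \<otimes> b) [^] n \<otimes> a"
proof (induction n)
  case (Suc n)
  have "a \<otimes> (b \<otimes> a) [^] Suc n = (a \<otimes> (b \<otimes> a) [^] n) \<otimes> (b \<otimes> a)"
    using assms by (simp add: m_assoc)
  then show ?case using assms by (simp add: Suc m_assoc)
qed (use assms in auto)

lemma inv_alt_prod_mult_alt_prod:
  assumes "a \<in> S" "b \<in> S"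
  shows "inv (alt_prod b a n) \<otimes> alt_prod a b n = (a \<otimes> b) [^] n"
  using assms
proof (induction n arbitrary: a b)
  case (Suc n)
  have c: "a \<in> carrier W" "b \<in> carrier W" using Suc.prems by (auto simp: S_carrier)
  have "inv (alt_prod b a (Suc n)) \<otimes> alt_prod a b (Suc n)
      = a \<otimes> (inv (alt_prod a b n) \<otimes> alt_prod b a n) \<otimes> b"
    unfolding alt_prod_Suc_right[OF c] alt_prod_Suc_right[OF c(2,1)]
    using c Suc.prems by (simp add: inv_mult_group alt_prod_closed m_assoc S_inv)
  also have "\<dots> = a \<otimes> (b \<otimes> a) [^] n \<otimes> b" using Suc by simp
  also have "\<dots> = (a \<otimes> b) [^] Suc n"
    by (simp add: c mult_pow_swap m_assoc)
  finally show ?case .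
qed simp

text \<open>The braid relation: the two alternating words of length \<open>n\<close> differ by the
  factor \<open>(a \<otimes> b) [^] n\<close>, which is trivial at the order. For infinite order
  \<open>ord\<close> is 0 and both words are empty.\<close>

lemma alt_prod_commute_ord:
  assumes "a \<in> S" "b \<in> S"
  shows "alt_prod a b (ord (a \<otimes> b)) = alt_prod b a (ord (a \<otimes> b))"
proof -
  have c: "a \<in> carrier W" "b \<in> carrier W" using assms by (auto simp: S_carrier)
  have "inv (alt_prod b a (ord (a \<otimes> b))) \<otimes> alt_prod a b (ord (a \<otimes> b)) = \<one>"
    using inv_alt_prod_mult_alt_prod[OF assms] c by (simp add: pow_ord_eq_1)
  then show ?thesis
    using c by (metis alt_prod_closed inv_closed inv_equality inv_inv)
qed

end

section \<open>Parity of words and the length function\<close>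

context coxeter_system
begin

lemma relator_step_parity: "relator_step u v \<Longrightarrow> even (length u) = even (length v)"
proof (induction rule: relator_step.induct)
  case (1 u v s t)
  have "length (concat (replicate n [s, t])) = 2 * n" for n by (induction n) auto
  then show ?case by simp
qed

text \<open>This is the sign character: every relator has even length, so by
  \<open>presentation\<close> the parity depends only on the group element.\<close>

lemma word_parity:
  assumes "u \<in> lists S" "v \<in> lists S" "word_prod u = word_prod v"
  shows "even (length u) = even (length v)"
  using presentation[OF assms]
  by (induction rule: equivclp_induct) (auto dest: relator_step_parity)

lemma ex_reduced_word:
  assumes "w \<in> carrier W"
  shows "\<exists>ws. reduced_word ws w"
proof -
  from assms have "\<exists>n. \<exists>ws \<in> lists S. word_prod ws = w \<and> length ws = n" using ex_word by blast
  from LeastI_ex[OF this] show ?thesis by (auto simp: reduced_word_def len_def)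
qed

lemma len_word_prod_le: "ws \<in> lists S \<Longrightarrow> len (word_prod ws) \<le> length ws"
  unfolding len_def by (rule Least_le) blast

lemma len_one [simp]: "len \<one> = 0"
  using len_word_prod_le[of "[]"] by simp

lemma len_mult_le: "v \<in> carrier W \<Longrightarrow> w \<in> carrier W \<Longrightarrow> len (v \<otimes> w) \<le> len v + len w"
  by (metis append_in_lists_conv ex_reduced_word len_word_prod_le length_append reduced_word_def
      word_prod_append)

lemma len_inv_le:
  assumes "w \<in> carrier W"
  shows "len (inv w) \<le> len w"
proof -
  obtain ws where "reduced_word ws w" using ex_reduced_word[OF assms] by blast
  then show ?thesis using len_word_prod_le[of "rev ws"]
    by (auto simp: reduced_word_def inv_word_prod in_lists_conv_set)
qed

lemma len_inv: "w \<in> carrier W \<Longrightarrow> len (inv w) = len w"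
  using len_inv_le[of w] len_inv_le[of "inv w"] by simp

lemma len_S_le: "s \<in> S \<Longrightarrow> len s \<le> 1"
  using len_word_prod_le[of "[s]"] by (simp add: S_carrier)

lemma len_alt_prod_le: "a \<in> S \<Longrightarrow> b \<in> S \<Longrightarrow> len (alt_prod a b n) \<le> n"
proof (induction n)
  case (Suc n)
  then have "len (alt_prod a b (Suc n)) \<le> len (if even n then b else a) + len (alt_prod a b n)"
    by (auto intro!: len_mult_le simp: alt_prod_closed S_carrier)
  then show ?case using Suc len_S_le[of a] len_S_le[of b] by (auto split: if_splits)
qed simp

text \<open>A generator changes the length by at most one, and parity excludes equality.\<close>

lemma len_mult_S:
  assumes "w \<in> carrier W" "s \<in> S"
  shows "len (w \<otimes> s) = Suc (len w) \<or> len w = Suc (len (w \<otimes> s))"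
proof -
  have sc: "s \<in> carrier W" using assms S_carrier by blast
  obtain us where us: "us \<in> lists S" "word_prod us = w" "length us = len w"
    using ex_reduced_word[OF assms(1)] by (auto simp: reduced_word_def)
  obtain vs where vs: "vs \<in> lists S" "word_prod vs = w \<otimes> s" "length vs = len (w \<otimes> s)"
    using ex_reduced_word[of "w \<otimes> s"] assms sc by (auto simp: reduced_word_def)
  have "even (length (us @ [s])) = even (length vs)"
    using us vs assms sc by (intro word_parity) (auto simp: word_prod_append)
  then have "len (w \<otimes> s) \<noteq> len w" using us vs by auto
  moreover have "len (w \<otimes> s) \<le> len w + 1"
    using len_mult_le[OF assms(1) sc] len_S_le[OF assms(2)] by simp
  moreover have "len w \<le> len (w \<otimes> s) + 1"
    using len_mult_le[of "w \<otimes> s" s] assms sc len_S_le[OF assms(2)]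
    by (simp add: m_assoc S_involution)
  ultimately show ?thesis by linarith
qed

lemma right_descent_exists:
  assumes "w \<in> carrier W" "w \<noteq> \<one>"
  shows "\<exists>s \<in> S. len w = Suc (len (w \<otimes> s))"
proof -
  obtain ws where ws: "ws \<in> lists S" "word_prod ws = w" "length ws = len w"
    using ex_reduced_word[OF assms(1)] by (auto simp: reduced_word_def)
  with assms obtain us s where us: "ws = us @ [s]"
    by (metis rev_exhaust word_prod_simps(1))
  have "s \<in> S" "us \<in> lists S" "s \<in> carrier W" using ws us S_carrier by auto
  moreover from this have "w = word_prod us \<otimes> s"
    using ws(2) us by (simp add: word_prod_append)
  moreover from calculation have "w \<otimes> s = word_prod us"
    by (simp add: m_assoc S_involution)
  ultimately show ?thesis
    using len_word_prod_le[of us] ws us len_mult_S[OF assms(1), of s] by (intro bexI[of _ s]) auto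
qed

end

subsection \<open>Positive and negative roots\<close>

context geometric_representation
begin

section \<open>Linearity of the action and invariance of the form\<close>

lemmas B_simps = bilinear_ladd[OF B_bilinear] bilinear_radd[OF B_bilinear]
  bilinear_lmul[OF B_bilinear] bilinear_rmul[OF B_bilinear]
  bilinear_lsub[OF B_bilinear] bilinear_rsub[OF B_bilinear]
  bilinear_lneg[OF B_bilinear] bilinear_rneg[OF B_bilinear]

lemma group_action_act: "group_action W UNIV act"
  using faithful_act by (simp add: faithful_action_def)

lemma act_one [simp]: "act \<one> v = v"
  by (metis UNIV_I group_action.id_eq_one[OF group_action_act] restrict_apply')

lemma act_mult: "x \<in> carrier W \<Longrightarrow> y \<in> carrier W \<Longrightarrow> act (x \<otimes> y) v = act x (act y v)"
  using group_action.composition_rule[OF group_action_act] by simp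

lemma act_inv_act [simp]: "x \<in> carrier W \<Longrightarrow> act (inv x) (act x v) = v"
  by (simp flip: act_mult)

lemma act_act_inv [simp]: "x \<in> carrier W \<Longrightarrow> act x (act (inv x) v) = v"
  by (simp flip: act_mult)

lemma act_eqD:
  assumes "x \<in> carrier W" "y \<in> carrier W" "\<And>v. act x v = act y v"
  shows "x = y"
  using faithful_act assms unfolding faithful_action_def faithful_action_axioms_def
  by (auto dest: inj_onD)

lemma linear_act: "w \<in> carrier W \<Longrightarrow> linear (act w)"
proof (induction rule: carrier_induct)
  case one
  have "act \<one> = id" by auto
  then show ?case by (simp only: linear_id)
next
  case (mult s w)
  have "linear (act s)"
    using mult(1) by (intro linearI) (auto simp: act_simple B_simps algebra_simps)
  moreover have "act (s \<otimes> w) = act s \<circ> act w"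
    using mult S_carrier by (auto simp: act_mult)
  ultimately show ?case using mult by (simp only: linear_compose)
qed

lemma act_simps:
  assumes "w \<in> carrier W"
  shows "act w (x + y) = act w x + act w y" "act w (x - y) = act w x - act w y"
    "act w (c *\<^sub>R x) = c *\<^sub>R act w x" "act w (- x) = - act w x" "act w 0 = 0"
  using linear_act[OF assms]
  by (simp_all add: linear_add linear_diff linear_cmul linear_neg linear_0)

lemma B_act: "w \<in> carrier W \<Longrightarrow> B (act w x) (act w y) = B x y"
proof (induction rule: carrier_induct)
  case (mult s w)
  have *: "B (act s x) (act s y) = B x y" for x y
    using mult(1) B_diag[of s] B_sym[of x "\<alpha> s"] by (simp add: act_simple B_simps algebra_simps)
  show ?case using mult by (simp add: act_mult S_carrier *)
qed simp

section \<open>The cone over the simple roots\<close>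

lemma cone_I: "(\<And>s. s \<in> S \<Longrightarrow> 0 \<le> a s) \<Longrightarrow> (\<Sum>s\<in>S. a s *\<^sub>R \<alpha> s) \<in> simple_cone"
  unfolding simple_cone_def by blast

lemma cone_add:
  assumes "x \<in> simple_cone" "y \<in> simple_cone"
  shows "x + y \<in> simple_cone"
proof -
  obtain a b where "x = (\<Sum>s\<in>S. a s *\<^sub>R \<alpha> s)" "\<forall>s\<in>S. 0 \<le> a s"
      "y = (\<Sum>s\<in>S. b s *\<^sub>R \<alpha> s)" "\<forall>s\<in>S. 0 \<le> b s"
    using assms unfolding simple_cone_def by blast
  then show ?thesis using cone_I[of "\<lambda>s. a s + b s"] by (simp add: scaleR_add_left sum.distrib)
qed

lemma cone_scale:
  assumes "x \<in> simple_cone" "0 \<le> c"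
  shows "c *\<^sub>R x \<in> simple_cone"
proof -
  obtain a where "x = (\<Sum>s\<in>S. a s *\<^sub>R \<alpha> s)" "\<forall>s\<in>S. 0 \<le> a s"
    using assms unfolding simple_cone_def by blast
  then show ?thesis using cone_I[of "\<lambda>s. c * a s"] assms by (simp add: scaleR_sum_right)
qed

lemma simple_in_cone:
  assumes "s \<in> S"
  shows "\<alpha> s \<in> simple_cone"
proof -
  have "(\<Sum>t\<in>S. (if t = s then 1 else 0) *\<^sub>R \<alpha> t) = (\<Sum>t\<in>S. if t = s then \<alpha> t else 0)"
    by (intro sum.cong) auto
  then have "\<alpha> s = (\<Sum>t\<in>S. (if t = s then 1 else 0) *\<^sub>R \<alpha> t)"
    using assms finite_S by simp
  then show ?thesis using cone_I[of "\<lambda>t. if t = s then 1 else 0"] by simp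
qed

lemma cone_sum_zero:
  assumes "\<And>s. s \<in> S \<Longrightarrow> 0 \<le> a s" "\<And>s. s \<in> S \<Longrightarrow> 0 \<le> b s"
    "(\<Sum>s\<in>S. a s *\<^sub>R \<alpha> s) + (\<Sum>s\<in>S. b s *\<^sub>R \<alpha> s) = 0" "s \<in> S"
  shows "a s = 0"
proof -
  have "a s + b s = 0"
    by (rule positively_independent[of "\<lambda>s. a s + b s"])
      (use assms in \<open>auto simp: scaleR_add_left sum.distrib add_nonneg_nonneg\<close>)
  then show ?thesis using assms(1,2)[OF assms(4)] by linarith
qed

text \<open>This takes the place of uniqueness of coefficients, as simple roots may be linearly
  dependent: it keeps a root from being both positive and negative.\<close>

lemma cone_pointed:
  assumes "x \<in> simple_cone" "- x \<in> simple_cone"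
  shows "x = 0"
proof -
  obtain a b where ab: "x = (\<Sum>s\<in>S. a s *\<^sub>R \<alpha> s)" "\<forall>s\<in>S. 0 \<le> a s"
      "- x = (\<Sum>s\<in>S. b s *\<^sub>R \<alpha> s)" "\<forall>s\<in>S. 0 \<le> b s"
    using assms unfolding simple_cone_def by blast
  have "(\<Sum>s\<in>S. a s *\<^sub>R \<alpha> s) + (\<Sum>s\<in>S. b s *\<^sub>R \<alpha> s) = 0"
    unfolding ab(1,3)[symmetric] by simp
  then have "\<forall>s\<in>S. a s = 0" using ab by (auto intro!: cone_sum_zero[of a b])
  then show ?thesis using ab by simp
qed

section \<open>The rank two computation\<close>

text \<open>Up to an index shift these are the Chebyshev polynomials of the second kind. They give
  the coefficients of the images of a simple root under alternating words.\<close>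

fun cheb :: "real \<Rightarrow> nat \<Rightarrow> real" where
  "cheb c 0 = 0"
| "cheb c (Suc 0) = 1"
| "cheb c (Suc (Suc n)) = 2 * c * cheb c (Suc n) - cheb c n"

lemma cheb_mono: "1 \<le> c \<Longrightarrow> 0 \<le> cheb c n \<and> cheb c n \<le> cheb c (Suc n)"
proof (induction n)
  case (Suc n)
  then have "1 * cheb c (Suc n) \<le> c * cheb c (Suc n)" by (intro mult_right_mono) auto
  then show ?case using Suc by auto
qed auto

lemma cheb_cos: "cheb (cos \<theta>) n * sin \<theta> = sin (real n * \<theta>)"
proof (induction n rule: induct_nat_012)
  case (ge2 n)
  have "sin (real (Suc (Suc n)) * \<theta>) + sin (real n * \<theta>) = 2 * cos \<theta> * sin (real (Suc n) * \<theta>)"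
    using sin_add[of "real (Suc n) * \<theta>" \<theta>] sin_diff[of "real (Suc n) * \<theta>" \<theta>]
    by (simp add: algebra_simps)
  then show ?case using ge2 by (simp add: algebra_simps)
qed auto

text \<open>For finite order \<open>m\<close> the argument is \<open>cos (pi / m)\<close>, and
  \<open>sin (n * pi / m)\<close> is nonnegative up to \<open>n = m\<close>. For infinite order the
  argument is at least 1 and the sequence is nondecreasing.\<close>

lemma cheb_nonneg:
  assumes "a \<in> S" "b \<in> S" "a \<noteq> b" "ord (a \<otimes> b) = 0 \<or> n \<le> ord (a \<otimes> b)"
  shows "0 \<le> cheb (- B (\<alpha> a) (\<alpha> b)) n"
proof (cases "ord (a \<otimes> b) = 0")
  case True
  then show ?thesis using B_infinite_order[of a b] assms cheb_mono by simp
next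
  case False
  define m where "m = ord (a \<otimes> b)"
  have "m \<noteq> 1" using ord_ne_1[OF assms(1-3)] by (simp add: m_def)
  then have m: "2 \<le> m" "n \<le> m" using False assms by (auto simp: m_def)
  define \<theta> where "\<theta> = pi / real m"
  have \<theta>: "0 < \<theta>" "\<theta> < pi" using m by (auto simp: \<theta>_def field_simps)
  have "0 \<le> sin (real n * \<theta>)"
    by (rule sin_ge_zero) (use m in \<open>auto simp: \<theta>_def field_simps\<close>)
  then have "0 \<le> cheb (cos \<theta>) n * sin \<theta>" by (simp add: cheb_cos)
  then have "0 \<le> cheb (cos \<theta>) n" using sin_gt_zero[OF \<theta>] by (simp add: zero_le_mult_iff)
  then show ?thesis using B_finite_order[OF assms(1-3)] False by (simp add: \<theta>_def m_def)
qed

text \<open>Each new letter changes only the coefficient of its own simple root, and the change is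
  one step of the recursion of \<open>cheb\<close>.\<close>

lemma act_alt_prod:
  assumes "a \<in> S" "b \<in> S"
  shows "act (alt_prod a b n) (\<alpha> a) =
    (if even n then cheb (- B (\<alpha> a) (\<alpha> b)) (Suc n) *\<^sub>R \<alpha> a + cheb (- B (\<alpha> a) (\<alpha> b)) n *\<^sub>R \<alpha> b
     else cheb (- B (\<alpha> a) (\<alpha> b)) n *\<^sub>R \<alpha> a + cheb (- B (\<alpha> a) (\<alpha> b)) (Suc n) *\<^sub>R \<alpha> b)"
proof (induction n)
  case (Suc n)
  have c: "a \<in> carrier W" "b \<in> carrier W" using assms S_carrier by auto
  show ?case
    using assms c B_sym[of "\<alpha> b" "\<alpha> a"]
    by (simp add: act_mult alt_prod_closed Suc act_simple B_simps B_diag algebra_simps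
        flip: scaleR_add_left)
qed simp

text \<open>Splitting off a maximal alternating word in \<open>s\<close> and a right descent \<open>t\<close> of \<open>w\<close> leaves a
  shorter \<open>v\<close> with \<open>v(\<alpha>\<^sub>s), v(\<alpha>\<^sub>t)\<close> in the cone, by induction; the rest is the rank two
  computation above.\<close>

lemma act_simple_in_cone:
  "w \<in> carrier W \<Longrightarrow> s \<in> S \<Longrightarrow> len w < len (w \<otimes> s) \<Longrightarrow> act w (\<alpha> s) \<in> simple_cone"
proof (induction "len w" arbitrary: w s rule: less_induct)
  case less
  note w = less.prems(1) and s = less.prems(2)
  show ?case
  proof (cases "w = \<one>")
    case True
    then show ?thesis using simple_in_cone s by simp
  next
    case False
    obtain t where t: "t \<in> S" "len w = Suc (len (w \<otimes> t))"
      using right_descent_exists[OF w False] by blast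
    have ts: "s \<noteq> t" using t less.prems by auto
    have c: "s \<in> carrier W" "t \<in> carrier W" using s t S_carrier by auto
    \<comment> \<open>\<open>P n\<close> splits off an alternating right factor of \<open>n\<close>
      letters with additive lengths. The descent \<open>t\<close> gives \<open>P 1\<close>, and a
      maximal \<open>n\<close> is chosen.\<close>
    define P where "P n \<longleftrightarrow> (\<exists>v \<in> carrier W. w = v \<otimes> alt_prod s t n \<and> len w = len v + n)" for n
    have ac: "alt_prod s t n \<in> carrier W" for n using c by (simp add: alt_prod_closed)
    have "P 1" unfolding P_def
      using w c t by (intro bexI[of _ "w \<otimes> t"]) (auto simp: m_assoc S_involution)
    moreover have bound: "\<And>n. P n \<Longrightarrow> n \<le> len w" by (auto simp: P_def)
    ultimately obtain n where n: "P n" "\<And>k. P k \<Longrightarrow> k \<le> n"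
      using Nat.ex_has_greatest_nat[of P 1 "len w"] by blast
    then have "1 \<le> n" using \<open>P 1\<close> by blast
    obtain v where v: "v \<in> carrier W" "w = v \<otimes> alt_prod s t n" "len w = len v + n"
      using n(1) by (auto simp: P_def)
    \<comment> \<open>\<open>x k\<close> is the letter that extends \<open>alt_prod s t k\<close> on
      the left, so \<open>x (n - 1)\<close> is the first letter of the factor split off.\<close>
    define x where "x k = (if even k then t else s)" for k :: nat
    have x: "x k \<in> S" "x k \<in> carrier W" "x k \<otimes> x k = \<one>" for k
      using s t c by (auto simp: x_def S_involution)
    have alt_Suc: "alt_prod s t (Suc k) = x k \<otimes> alt_prod s t k" for k by (simp add: x_def)
    \<comment> \<open>A descent here would move one more letter into the alternating factor, against
      maximality.\<close>
    have "len v < len (v \<otimes> x n)"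
    proof (rule ccontr)
      assume "\<not> ?thesis"
      then have "len v = Suc (len (v \<otimes> x n))" using len_mult_S[OF v(1) x(1)[of n]] by auto
      moreover have "w = (v \<otimes> x n) \<otimes> alt_prod s t (Suc n)"
        unfolding alt_Suc using v ac x by (simp add: m_assoc flip: m_assoc[of "x n" "x n"])
      ultimately have "P (Suc n)" unfolding P_def
        using v x by (intro bexI[of _ "v \<otimes> x n"]) auto
      then show False using n(2) by fastforce
    qed
    \<comment> \<open>A descent here would cancel the first letter of the factor and make
      \<open>w\<close> too short.\<close>
    moreover have "len v < len (v \<otimes> x (n - 1))"
    proof (rule ccontr)
      assume "\<not> ?thesis"
      then have l: "len v = Suc (len (v \<otimes> x (n - 1)))" using len_mult_S[OF v(1) x(1)[of "n-1"]] by auto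
      have "w = (v \<otimes> x (n - 1)) \<otimes> alt_prod s t (n - 1)"
        using v alt_Suc[of "n - 1"] \<open>1 \<le> n\<close> ac x by (simp add: m_assoc)
      then have "len w \<le> len (v \<otimes> x (n - 1)) + (n - 1)"
        using len_mult_le[of "v \<otimes> x (n - 1)" "alt_prod s t (n - 1)"] len_alt_prod_le[OF s t(1), of "n-1"]
          v x ac by fastforce
      then show False using l v by simp
    qed
    ultimately have "len v < len (v \<otimes> s)" "len v < len (v \<otimes> t)"
      using \<open>1 \<le> n\<close> by (cases "even n"; auto simp: x_def)+
    then have vc: "act v (\<alpha> s) \<in> simple_cone" "act v (\<alpha> t) \<in> simple_cone"
      using less.hyps[of v] v \<open>1 \<le> n\<close> s t by auto
    \<comment> \<open>If \<open>n\<close> reached the finite order \<open>m\<close>, a factor of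
      \<open>m\<close> letters could be split off; the braid relation lets it end in
      \<open>s\<close>, contradicting \<open>len w < len (w \<otimes> s)\<close>.\<close>
    have ord: "ord (s \<otimes> t) = 0 \<or> Suc n \<le> ord (s \<otimes> t)"
    proof (rule ccontr)
      define m where "m = ord (s \<otimes> t)"
      assume "\<not> ?thesis"
      then have m: "0 < m" "m \<le> n" by (auto simp: m_def)
      \<comment> \<open>Leading letters are given back to the left factor one at a time; its length
        is pinned from both sides.\<close>
      have "P k" if "k \<le> n" for k
        using that
      proof (induction rule: inc_induct)
        case (step k)
        then obtain u where u: "u \<in> carrier W" "w = u \<otimes> alt_prod s t (Suc k)"
            "len w = len u + Suc k" by (auto simp: P_def)
        have w': "w = (u \<otimes> x k) \<otimes> alt_prod s t k"
          using u ac x unfolding alt_Suc by (simp add: m_assoc)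
        then have "len w \<le> len (u \<otimes> x k) + k"
          using len_mult_le[of "u \<otimes> x k" "alt_prod s t k"] len_alt_prod_le[OF s t(1), of k]
            u x ac by fastforce
        moreover have "len (u \<otimes> x k) \<le> len u + 1"
          using len_mult_le[of u "x k"] len_S_le[OF x(1)[of k]] u x by fastforce
        ultimately show ?case unfolding P_def
          using u w' x by (intro bexI[of _ "u \<otimes> x k"]) auto
      qed (use n in auto)
      then obtain u where u: "u \<in> carrier W" "w = u \<otimes> alt_prod s t m" "len w = len u + m"
        using m by (auto simp: P_def)
      obtain k where k: "m = Suc k" using m by (cases m) auto
      have "alt_prod s t m = alt_prod s t k \<otimes> s"
        using alt_prod_commute_ord[OF s t(1)] alt_prod_Suc_right[OF c(2,1), of k]
        unfolding m_def[symmetric] k by (simp only:)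
      then have "w \<otimes> s = u \<otimes> alt_prod s t k"
        using u ac c s by (simp add: m_assoc S_involution)
      then have "len (w \<otimes> s) \<le> len u + k"
        using len_mult_le[of u "alt_prod s t k"] len_alt_prod_le[OF s t(1), of k] u ac by fastforce
      then show False using less.prems u k by simp
    qed
    have "0 \<le> cheb (- B (\<alpha> s) (\<alpha> t)) n" "0 \<le> cheb (- B (\<alpha> s) (\<alpha> t)) (Suc n)"
      using ord by (auto intro!: cheb_nonneg s t ts simp del: cheb.simps)
    then show ?thesis
      using v(1,2) vc ac s t
      by (auto simp: act_mult act_alt_prod act_simps simp del: cheb.simps intro!: cone_add cone_scale)
  qed
qed

section \<open>Roots and their signs\<close>

lemma simple_root: "s \<in> S \<Longrightarrow> \<alpha> s \<in> roots"
  unfolding roots_def using act_one one_closed by (metis (mono_tags, lifting) mem_Collect_eq)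

lemma act_root:
  assumes "x \<in> carrier W" "\<beta> \<in> roots"
  shows "act x \<beta> \<in> roots"
proof -
  obtain w s where "\<beta> = act w (\<alpha> s)" "w \<in> carrier W" "s \<in> S"
    using assms(2) by (auto simp: roots_def)
  then have "act x \<beta> = act (x \<otimes> w) (\<alpha> s)" "x \<otimes> w \<in> carrier W" "s \<in> S"
    using assms by (auto simp: act_mult)
  then show ?thesis unfolding roots_def by blast
qed

lemma root_norm: "\<beta> \<in> roots \<Longrightarrow> B \<beta> \<beta> = 1"
  unfolding roots_def using B_act B_diag by auto

lemma neg_root:
  assumes "\<beta> \<in> roots"
  shows "- \<beta> \<in> roots"
proof -
  obtain w s where w: "\<beta> = act w (\<alpha> s)" "w \<in> carrier W" "s \<in> S"
    using assms by (auto simp: roots_def)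
  have "act s (\<alpha> s) = - \<alpha> s" using w by (simp add: act_simple B_diag scaleR_2)
  then have "- \<beta> = act w (act s (\<alpha> s))" using w by (simp add: act_simps)
  then show ?thesis using w act_root[OF w(2) act_root[OF S_carrier simple_root]] by simp
qed

lemma root_nonzero: "\<beta> \<in> roots \<Longrightarrow> \<beta> \<noteq> 0"
  using root_norm[of 0] bilinear_lzero[OF B_bilinear] by auto

text \<open>If \<open>s\<close> is a descent of \<open>w\<close>, it is an ascent of
  \<open>w \<otimes> s\<close>, which takes \<open>\<alpha> s\<close> to the negative of the
  root.\<close>

lemma root_pos_or_neg:
  assumes "\<beta> \<in> roots"
  shows "\<beta> \<in> simple_cone \<or> - \<beta> \<in> simple_cone"
proof -
  obtain w s where w: "\<beta> = act w (\<alpha> s)" "w \<in> carrier W" "s \<in> S"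
    using assms by (auto simp: roots_def)
  have c: "s \<in> carrier W" using w S_carrier by auto
  show ?thesis
  proof (cases "len w < len (w \<otimes> s)")
    case True
    then show ?thesis using act_simple_in_cone w by blast
  next
    case False
    then have "len (w \<otimes> s) < len ((w \<otimes> s) \<otimes> s)"
      using len_mult_S[OF w(2,3)] w c by (auto simp: m_assoc S_involution)
    then have "act (w \<otimes> s) (\<alpha> s) \<in> simple_cone" using w c by (intro act_simple_in_cone) auto
    moreover have "act (w \<otimes> s) (\<alpha> s) = - \<beta>"
      using w c by (simp add: act_mult act_simple B_diag scaleR_2 act_simps)
    ultimately show ?thesis by simp
  qed
qed

lemma root_not_pos_and_neg: "\<beta> \<in> roots \<Longrightarrow> \<beta> \<in> simple_cone \<Longrightarrow> - \<beta> \<notin> simple_cone"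
  using cone_pointed root_nonzero by blast

lemma pos_roots_iff: "\<beta> \<in> pos_roots \<longleftrightarrow> \<beta> \<in> roots \<and> \<beta> \<in> simple_cone"
  by (simp add: pos_roots_def)

lemma inversion_set_iff:
  "w \<in> carrier W \<Longrightarrow>
    \<beta> \<in> inversion_set w \<longleftrightarrow> \<beta> \<in> pos_roots \<and> - act (inv w) \<beta> \<in> simple_cone"
  using neg_root[OF act_root[of "inv w" \<beta>]]
  by (force simp: inversion_set_def neg_roots_def pos_roots_iff image_iff)

text \<open>Roots have norm one, so the factor is 1 or -1, and the sign decides.\<close>

lemma pos_roots_parallel:
  assumes "\<beta> \<in> pos_roots" "\<gamma> \<in> pos_roots" "\<beta> = c *\<^sub>R \<gamma>"
  shows "\<beta> = \<gamma>"
proof -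
  have r: "\<beta> \<in> roots" "\<gamma> \<in> roots" using assms by (auto simp: pos_roots_iff)
  have "c * c = 1" using root_norm[OF r(1)] root_norm[OF r(2)] assms(3) by (simp add: B_simps)
  then have "c = 1 \<or> c = -1" by (simp add: square_eq_1_iff)
  then show ?thesis
    using assms root_not_pos_and_neg[of \<gamma>] by (auto simp: pos_roots_iff)
qed

section \<open>Reflections and their roots\<close>

lemma reflections_carrier: "t \<in> reflections \<Longrightarrow> t \<in> carrier W"
  by (auto simp: reflections_def S_carrier)

lemma act_conj:
  assumes "w \<in> carrier W" "t \<in> carrier W" "\<And>v. act t v = v - (2 * B \<beta> v) *\<^sub>R \<beta>"
  shows "act (w \<otimes> t \<otimes> inv w) v = v - (2 * B (act w \<beta>) v) *\<^sub>R act w \<beta>"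
proof -
  have "B \<beta> (act (inv w) v) = B (act w \<beta>) v"
    using B_act[OF assms(1), of \<beta> "act (inv w) v"] assms by simp
  then show ?thesis using assms by (simp add: act_mult act_simps)
qed

text \<open>Faithfulness makes the element described by \<open>THE\<close> unique.\<close>

lemma root_reflection_eq:
  assumes "t \<in> reflections" "\<And>v. act t v = v - (2 * B \<beta> v) *\<^sub>R \<beta>"
  shows "root_reflection \<beta> = t"
  unfolding root_reflection_def
proof (rule the_equality)
  fix t' assume "t' \<in> reflections \<and> (\<forall>v. act t' v = v - (2 * B \<beta> v) *\<^sub>R \<beta>)"
  then show "t' = t" using assms by (intro act_eqD) (auto simp: reflections_carrier)
qed (use assms in auto)

lemma root_reflection_conj_simple:
  assumes "w \<in> carrier W" "s \<in> S"
  shows "root_reflection (act w (\<alpha> s)) = w \<otimes> s \<otimes> inv w"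
proof (rule root_reflection_eq)
  show "w \<otimes> s \<otimes> inv w \<in> reflections" using assms unfolding reflections_def by blast
  show "act (w \<otimes> s \<otimes> inv w) v = v - (2 * B (act w (\<alpha> s)) v) *\<^sub>R act w (\<alpha> s)" for v
    using assms S_carrier act_simple by (intro act_conj) auto
qed

lemma root_reflection_mem:
  assumes "\<beta> \<in> roots"
  shows "root_reflection \<beta> \<in> reflections"
  using assms root_reflection_conj_simple by (fastforce simp: roots_def reflections_def)

lemma root_reflection_carrier: "\<beta> \<in> roots \<Longrightarrow> root_reflection \<beta> \<in> carrier W"
  using root_reflection_mem reflections_carrier by blast

lemma act_root_reflection:
  assumes "\<beta> \<in> roots"
  shows "act (root_reflection \<beta>) v = v - (2 * B \<beta> v) *\<^sub>R \<beta>"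
proof -
  obtain w s where "\<beta> = act w (\<alpha> s)" "w \<in> carrier W" "s \<in> S"
    using assms by (auto simp: roots_def)
  then show ?thesis
    using root_reflection_conj_simple act_conj[of w s "\<alpha> s" v] act_simple S_carrier by auto
qed

lemma root_reflection_act:
  assumes "\<beta> \<in> roots" "w \<in> carrier W"
  shows "root_reflection (act w \<beta>) = w \<otimes> root_reflection \<beta> \<otimes> inv w"
proof -
  obtain x s where x: "\<beta> = act x (\<alpha> s)" "x \<in> carrier W" "s \<in> S"
    using assms by (auto simp: roots_def)
  then show ?thesis
    using root_reflection_conj_simple[of x s] root_reflection_conj_simple[of "w \<otimes> x" s] assms S_carrier
    by (simp add: act_mult m_assoc inv_mult_group)
qed

lemma root_reflection_neg: "\<beta> \<in> roots \<Longrightarrow> root_reflection (- \<beta>) = root_reflection \<beta>"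
  by (intro root_reflection_eq) (auto simp: root_reflection_mem act_root_reflection B_simps)

lemma act_root_reflection_self [simp]: "\<beta> \<in> roots \<Longrightarrow> act (root_reflection \<beta>) \<beta> = - \<beta>"
  by (simp add: act_root_reflection root_norm scaleR_2)

lemma root_reflection_square: "\<beta> \<in> roots \<Longrightarrow> root_reflection \<beta> \<otimes> root_reflection \<beta> = \<one>"
  by (rule act_eqD)
    (auto simp: root_reflection_carrier act_mult act_root_reflection B_simps root_norm)

lemma act_root_reflection_twice [simp]:
  "\<beta> \<in> roots \<Longrightarrow> act (root_reflection \<beta>) (act (root_reflection \<beta>) v) = v"
  by (simp add: root_reflection_carrier root_reflection_square flip: act_mult)

lemma root_reflection_inv: "\<beta> \<in> roots \<Longrightarrow> inv (root_reflection \<beta>) = root_reflection \<beta>"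
  using root_reflection_square root_reflection_carrier by (intro inv_equality) auto

text \<open>The reflection in \<open>\<gamma>\<close> negates \<open>\<beta>\<close>, so
  \<open>\<beta>\<close> is a multiple of \<open>\<gamma>\<close>.\<close>

lemma root_reflection_inj:
  assumes "\<beta> \<in> pos_roots" "\<gamma> \<in> pos_roots" "root_reflection \<beta> = root_reflection \<gamma>"
  shows "\<beta> = \<gamma>"
proof -
  have r: "\<beta> \<in> roots" "\<gamma> \<in> roots" using assms by (auto simp: pos_roots_iff)
  have "- \<beta> = \<beta> - (2 * B \<gamma> \<beta>) *\<^sub>R \<gamma>"
    using act_root_reflection[OF r(2)] act_root_reflection_self[OF r(1)] assms(3) by metis
  then have "2 *\<^sub>R \<beta> = 2 *\<^sub>R (B \<gamma> \<beta> *\<^sub>R \<gamma>)" by (simp add: scaleR_2 algebra_simps)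
  then have "\<beta> = B \<gamma> \<beta> *\<^sub>R \<gamma>" by (metis scaleR_left_imp_eq zero_neq_numeral)
  then show ?thesis using pos_roots_parallel assms by blast
qed

lemma reflection_root_root_reflection: "\<beta> \<in> pos_roots \<Longrightarrow> reflection_root (root_reflection \<beta>) = \<beta>"
  unfolding reflection_root_def using root_reflection_inj by (intro the_equality) auto

lemma reflection_root_props:
  assumes "t \<in> reflections"
  shows "reflection_root t \<in> pos_roots \<and> root_reflection (reflection_root t) = t"
proof -
  obtain w s where w: "t = w \<otimes> s \<otimes> inv w" "w \<in> carrier W" "s \<in> S"
    using assms by (auto simp: reflections_def)
  define \<beta> where "\<beta> = act w (\<alpha> s)"
  have r: "\<beta> \<in> roots" unfolding \<beta>_def roots_def using w by blast
  have t: "root_reflection \<beta> = t" "root_reflection (- \<beta>) = t"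
    using w r root_reflection_conj_simple[of w s] root_reflection_neg by (auto simp: \<beta>_def)
  obtain \<gamma> where "\<gamma> \<in> pos_roots" "root_reflection \<gamma> = t"
    using root_pos_or_neg[OF r] t r neg_root[OF r] by (auto simp: pos_roots_iff)
  then show ?thesis using reflection_root_root_reflection by metis
qed

section \<open>Action of simple reflections on positive roots\<close>

text \<open>At index 2 the polynomial is twice its argument, and a product of two distinct
  generators does not have order 1.\<close>

lemma B_simple_nonpos:
  assumes "a \<in> S" "b \<in> S" "a \<noteq> b"
  shows "B (\<alpha> a) (\<alpha> b) \<le> 0"
proof -
  have "0 \<le> cheb (- B (\<alpha> a) (\<alpha> b)) 2"
    using assms ord_ne_1[OF assms] by (intro cheb_nonneg) auto
  then show ?thesis by (simp add: numeral_2_eq_2)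
qed

lemma B_simple_sum:
  assumes "s \<in> S"
  shows "B (\<alpha> s) (\<Sum>t\<in>S. a t *\<^sub>R \<alpha> t) = (\<Sum>t\<in>S. a t * B (\<alpha> s) (\<alpha> t))"
proof -
  have "linear (B (\<alpha> s))" using B_bilinear by (simp add: bilinear_def)
  then show ?thesis by (simp add: linear_sum linear_cmul)
qed

text \<open>The simple roots need not be linearly independent; the case of a negative coefficient at
  \<open>s\<close> is ruled out by pairing with \<open>\<alpha> s\<close>.\<close>

lemma simple_permutes_pos_roots:
  assumes s: "s \<in> S" and \<beta>: "\<beta> \<in> pos_roots" "\<beta> \<noteq> \<alpha> s"
  shows "act s \<beta> \<in> pos_roots"
proof (rule ccontr)
  assume neg: "\<not> ?thesis"
  have r: "\<beta> \<in> roots" "act s \<beta> \<in> roots" using \<beta> act_root s S_carrier by (auto simp: pos_roots_iff)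
  then have "- act s \<beta> \<in> simple_cone" using root_pos_or_neg[of "act s \<beta>"] neg by (auto simp: pos_roots_iff)
  then obtain b where b: "- act s \<beta> = (\<Sum>t\<in>S. b t *\<^sub>R \<alpha> t)" "\<And>t. t \<in> S \<Longrightarrow> 0 \<le> b t"
    unfolding simple_cone_def by blast
  obtain a where a: "\<beta> = (\<Sum>t\<in>S. a t *\<^sub>R \<alpha> t)" "\<And>t. t \<in> S \<Longrightarrow> 0 \<le> a t"
    using \<beta> unfolding pos_roots_def simple_cone_def by blast
  define c where "c = 2 * B (\<alpha> s) \<beta>"
  \<comment> \<open>\<open>\<beta>\<close> and \<open>- act s \<beta>\<close> lie in the cone and
    add up to \<open>c\<close> times \<open>\<alpha> s\<close>; \<open>d\<close> collects the
    coefficients of the resulting relation, nonnegative away from \<open>s\<close>.\<close>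
  define d where "d t = a t + b t - (if t = s then c else 0)" for t
  have "c *\<^sub>R \<alpha> s = \<beta> + - act s \<beta>" using s by (simp add: c_def act_simple)
  then have "c *\<^sub>R \<alpha> s = (\<Sum>t\<in>S. (a t + b t) *\<^sub>R \<alpha> t)"
    unfolding b(1) by (subst (asm) a(1)) (simp add: scaleR_add_left sum.distrib)
  moreover have "(\<Sum>t\<in>S. (if t = s then c else 0) *\<^sub>R \<alpha> t) = (\<Sum>t\<in>S. if t = s then c *\<^sub>R \<alpha> t else 0)"
    by (intro sum.cong) auto
  then have "(\<Sum>t\<in>S. (if t = s then c else 0) *\<^sub>R \<alpha> t) = c *\<^sub>R \<alpha> s" using s finite_S by simp
  ultimately have d0: "(\<Sum>t\<in>S. d t *\<^sub>R \<alpha> t) = 0"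
    by (simp add: d_def scaleR_diff_left sum_subtractf)
  have d_nonneg: "0 \<le> d t" if "t \<in> S" "t \<noteq> s" for t using that a b by (simp add: d_def)
  have "0 \<le> d s"
  proof -
    have "0 = (\<Sum>t\<in>S. d t * B (\<alpha> s) (\<alpha> t))"
      using B_simple_sum[OF s, of d] d0 by (simp add: bilinear_rzero[OF B_bilinear])
    also have "\<dots> = d s + (\<Sum>t\<in>S - {s}. d t * B (\<alpha> s) (\<alpha> t))"
      using s finite_S by (simp add: sum.remove B_diag)
    also have "(\<Sum>t\<in>S - {s}. d t * B (\<alpha> s) (\<alpha> t)) \<le> 0"
      using d_nonneg B_simple_nonpos[OF s] by (intro sum_nonpos mult_nonneg_nonpos) auto
    finally show ?thesis by simp
  qed
  then have "d t = 0" if "t \<in> S" for t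
    using positively_independent[of d] d_nonneg d0 that by metis
  \<comment> \<open>Away from \<open>s\<close>, \<open>d t\<close> is a sum of two nonnegative
    coefficients, so \<open>\<beta>\<close> is a multiple of \<open>\<alpha> s\<close>.\<close>
  then have "a t = 0" if "t \<in> S" "t \<noteq> s" for t
    using a(2)[of t] b(2)[of t] that by (force simp: d_def)
  then have "(\<Sum>t\<in>S. a t *\<^sub>R \<alpha> t) = (\<Sum>t\<in>S. if t = s then a s *\<^sub>R \<alpha> s else 0)"
    by (intro sum.cong) auto
  then have "\<beta> = a s *\<^sub>R \<alpha> s" using a(1) s finite_S by simp
  then show False
    using pos_roots_parallel[OF \<beta>(1), of "\<alpha> s"] simple_root[OF s] simple_in_cone[OF s] \<beta>(2)
    by (auto simp: pos_roots_iff)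
qed

text \<open>Letters act from the right, and at some letter the image of \<open>d\<close> turns
  negative; a simple reflection does this only to its own simple root.\<close>

lemma inverted_root_in_word:
  assumes "ws \<in> lists S" "d \<in> pos_roots" "- act (word_prod ws) d \<in> simple_cone"
  shows "\<exists>us s vs. ws = us @ s # vs \<and> act (word_prod vs) d = \<alpha> s"
  using assms
proof (induction ws)
  case Nil
  then show ?case using root_not_pos_and_neg by (auto simp: pos_roots_iff)
next
  case (Cons s ws)
  then have s: "s \<in> S" "ws \<in> lists S" by auto
  have r: "act (word_prod ws) d \<in> roots" using act_root s Cons.prems by (auto simp: pos_roots_iff)
  show ?case
  proof (cases "- act (word_prod ws) d \<in> simple_cone")
    case True
    then obtain us s' vs where "ws = us @ s' # vs" "act (word_prod vs) d = \<alpha> s'"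
      using Cons by auto
    then show ?thesis by (intro exI[of _ "s # us"]) auto
  next
    case False
    then have "act (word_prod ws) d \<in> pos_roots" using root_pos_or_neg r by (auto simp: pos_roots_iff)
    moreover have "act s (act (word_prod ws) d) \<notin> pos_roots"
      using Cons.prems s S_carrier root_not_pos_and_neg
      by (auto simp: pos_roots_iff act_mult simp del: in_lists_conv_set)
    ultimately have "act (word_prod ws) d = \<alpha> s" using simple_permutes_pos_roots s by blast
    then show ?thesis by blast
  qed
qed

section \<open>Depth and length\<close>

lemma depth_le:
  assumes "w \<in> carrier W" "s \<in> S" "act w \<beta> = \<alpha> s"
  shows "depth \<beta> \<le> len w"
  unfolding depth_def by (rule Least_le) (use assms in auto)

lemma depth_attained:
  assumes "\<beta> \<in> roots"
  shows "\<exists>w \<in> carrier W. \<exists>s \<in> S. len w = depth \<beta> \<and> act w \<beta> = \<alpha> s"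
proof -
  obtain w s where w: "\<beta> = act w (\<alpha> s)" "w \<in> carrier W" "s \<in> S"
    using assms by (auto simp: roots_def)
  then have "\<exists>n. \<exists>w \<in> carrier W. len w = n \<and> act w \<beta> \<in> \<alpha> ` S"
    by (intro exI[of _ "len (inv w)"] bexI[of _ "inv w"]) auto
  from LeastI_ex[OF this] show ?thesis unfolding depth_def by blast
qed

text \<open>Along a reduced word, \<open>d\<close> becomes simple just before its sign changes. The
  letters to the right of that place bound the depth, and multiplying by the reflection deletes the
  letter there, as in the exchange condition.\<close>

lemma inverted_root_length:
  assumes w: "w \<in> carrier W" and d: "d \<in> pos_roots" and neg: "- act w d \<in> simple_cone"
  shows "depth d < len w" "len (w \<otimes> root_reflection d) < len w"
proof -
  obtain ws where ws: "ws \<in> lists S" "word_prod ws = w" "length ws = len w"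
    using ex_reduced_word[OF w] by (auto simp: reduced_word_def)
  then obtain us s vs where u: "ws = us @ s # vs" "act (word_prod vs) d = \<alpha> s"
    using inverted_root_in_word[of ws d] d neg by auto
  define x y where "x = word_prod us" and "y = word_prod vs"
  have S: "us \<in> lists S" "vs \<in> lists S" "s \<in> S" using ws(1) u(1) by auto
  then have c: "x \<in> carrier W" "y \<in> carrier W" "s \<in> carrier W" "s # vs \<in> lists S"
    by (auto simp: x_def y_def S_carrier intro!: word_prod_closed)
  have "depth d \<le> len y" using depth_le[OF c(2) S(3)] u by (simp add: y_def)
  also have "len y \<le> length vs" unfolding y_def using len_word_prod_le S by blast
  finally show "depth d < len w" using ws u by simp
  have "d = act (inv y) (\<alpha> s)" using u c by (metis act_inv_act y_def)
  then have "root_reflection d = inv y \<otimes> s \<otimes> y"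
    using root_reflection_conj_simple[of "inv y" s] c S by simp
  moreover have "w = x \<otimes> s \<otimes> y"
    using ws u word_prod_append[OF S(1) c(4)] c by (simp add: x_def y_def m_assoc)
  moreover have "y \<otimes> (inv y \<otimes> z) = z" if "z \<in> carrier W" for z
    using c that by (simp flip: m_assoc)
  ultimately have "w \<otimes> root_reflection d = x \<otimes> (s \<otimes> s) \<otimes> y"
    using c by (simp add: m_assoc)
  also have "\<dots> = word_prod (us @ vs)"
    using c S by (simp add: S_involution word_prod_append x_def y_def)
  finally have "len (w \<otimes> root_reflection d) \<le> length (us @ vs)"
    using len_word_prod_le[of "us @ vs"] S by simp
  then show "len (w \<otimes> root_reflection d) < len w" using ws u by simp
qed

text \<open>\<open>w\<close> conjugates the reflection in \<open>c\<close> to \<open>s\<close>. If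
  \<open>act w d\<close> is positive, it differs from \<open>\<alpha> s\<close>, which is
  \<open>act w c\<close>, so \<open>s\<close> keeps it positive.\<close>

lemma reflection_inversion_split:
  assumes w: "w \<in> carrier W" "s \<in> S" "act w c = \<alpha> s"
    and cd: "c \<in> pos_roots" "d \<in> pos_roots" "d \<noteq> c"
  shows "- act w d \<in> simple_cone \<or> act w (act (root_reflection c) d) \<in> simple_cone"
proof -
  have r: "c \<in> roots" "d \<in> roots" "act w d \<in> roots" using cd w act_root by (auto simp: pos_roots_iff)
  have "act w (act (root_reflection c) d) = act s (act w d)"
    using B_act[OF w(1), of c d] w r by (simp add: act_root_reflection act_simps act_simple)
  moreover have "act w d \<noteq> \<alpha> s" using w cd by (metis act_inv_act)
  ultimately show ?thesis
    using root_pos_or_neg[OF r(3)] simple_permutes_pos_roots[OF w(2), of "act w d"] r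
    by (auto simp: pos_roots_iff)
qed

section \<open>Prefixes of reflections and their inversions\<close>

text \<open>Splitting the reduced palindrome after its middle letter turns the condition on words
  into an equation in the group with additive lengths.\<close>

lemma reflection_prefix_decomp:
  assumes "reflection_prefix t p"
  shows "\<exists>u \<in> carrier W. \<exists>s \<in> S. p = u \<otimes> s \<and> t = p \<otimes> inv u \<and> len p = Suc (len u) \<and>
    len t = len p + len u"
proof -
  have p: "p \<in> carrier W" "p \<noteq> \<one>" using assms by (auto simp: reflection_prefix_def)
  obtain ws where ws: "reduced_word ws p" using ex_reduced_word[OF p(1)] by blast
  then have t: "reduced_word (ws @ rev (butlast ws)) t"
    using assms by (auto simp: reflection_prefix_def)
  have "ws \<noteq> []" using ws p by (auto simp: reduced_word_def)
  then obtain us s where us: "ws = us @ [s]" by (metis rev_exhaust)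
  have S: "us \<in> lists S" "s \<in> S" "[s] \<in> lists S" using ws us by (auto simp: reduced_word_def)
  have rS: "rev us \<in> lists S" "us @ [s] \<in> lists S" using S by (auto simp: in_lists_conv_set)
  define u where "u = word_prod us"
  have c: "u \<in> carrier W" "s \<in> carrier W" using S S_carrier by (auto simp: u_def)
  have 1: "p = u \<otimes> s" using ws us S c by (simp add: reduced_word_def u_def word_prod_append)
  have 2: "t = p \<otimes> inv u"
    using t ws us word_prod_append[OF rS(2,1)] S
    by (simp add: reduced_word_def u_def inv_word_prod)
  have l: "len u \<le> length us" "len p = Suc (length us)" "len t = 2 * length us + 1"
    using ws t us len_word_prod_le[OF S(1)] by (auto simp: reduced_word_def u_def)
  \<comment> \<open>Together with \<open>l\<close> this forces
    \<open>len u = length us\<close>.\<close>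
  have "len t \<le> len p + len u" using len_mult_le[of p "inv u"] len_inv 2 p c by simp
  then show ?thesis using 1 2 l c S by (intro bexI[of _ u] bexI[of _ s]) auto
qed

text \<open>With \<open>p = u \<otimes> s\<close>, the root of \<open>t\<close> is
  \<open>act u (\<alpha> s)\<close>. Additive lengths in \<open>t = p \<otimes> inv u\<close> keep
  \<open>p\<close> from inverting both \<open>d\<close> and \<open>- act t d\<close>; that one is
  inverted follows from \<open>inv u\<close> taking the root of \<open>t\<close> to
  \<open>\<alpha> s\<close>.\<close>

lemma prefix_inversions:
  assumes "reflection_prefix t p"
  defines "\<rho> \<equiv> reflection_root t"
  shows "\<rho> \<in> inversion_set p"
    and "\<And>d. d \<in> inversion_set p \<Longrightarrow> d \<noteq> \<rho> \<Longrightarrow> - act t d \<in> pos_roots - inversion_set p"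
    and "\<And>d. d \<in> pos_roots \<Longrightarrow> d \<noteq> \<rho> \<Longrightarrow> - act t d \<in> simple_cone \<Longrightarrow>
      d \<in> inversion_set p \<or> - act t d \<in> inversion_set p"
proof -
  obtain u s where u: "u \<in> carrier W" "s \<in> S" "p = u \<otimes> s" "t = p \<otimes> inv u"
      "len p = Suc (len u)" "len t = len p + len u"
    using reflection_prefix_decomp[OF assms(1)] by blast
  have c: "s \<in> carrier W" "p \<in> carrier W" "t \<in> carrier W" using u S_carrier by auto
  have "act u (\<alpha> s) \<in> simple_cone" using u by (intro act_simple_in_cone) auto
  then have pos: "act u (\<alpha> s) \<in> pos_roots" using u by (auto simp: pos_roots_iff roots_def)
  have t: "root_reflection (act u (\<alpha> s)) = t" using root_reflection_conj_simple u by simp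
  then have \<rho>: "\<rho> = act u (\<alpha> s)" using reflection_root_root_reflection[OF pos] by (simp add: \<rho>_def)
  then have \<rho>r: "\<rho> \<in> roots" "\<rho> \<in> pos_roots" "root_reflection \<rho> = t" using pos t by (auto simp: pos_roots_iff)
  have inv_p: "act (inv p) v = act s (act (inv u) v)" for v
    using u c by (simp add: inv_mult_group S_inv act_mult)
  have inv_t: "inv t = t" using root_reflection_inv[OF \<rho>r(1)] \<rho>r(3) by simp
  have s_neg: "act s (\<alpha> s) = - \<alpha> s" using u by (simp add: act_simple B_diag scaleR_2)
  show "\<rho> \<in> inversion_set p"
    using pos c u(1) simple_in_cone[OF u(2)] by (simp add: inversion_set_iff inv_p \<rho> s_neg)
  \<comment> \<open>Inversions of \<open>u\<close> stay inversions of \<open>p\<close>, since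
    \<open>s\<close> changes the sign of no positive root but \<open>\<alpha> s\<close>.\<close>
  have in_p: "d \<in> inversion_set p" if d: "d \<in> pos_roots" "d \<noteq> \<rho>" "- act (inv u) d \<in> simple_cone" for d
  proof -
    have dr: "d \<in> roots" "- act (inv u) d \<in> pos_roots"
      using d u act_root neg_root by (auto simp: pos_roots_iff)
    have "- act (inv u) d \<noteq> \<alpha> s"
    proof
      assume "- act (inv u) d = \<alpha> s"
      then have "act u (- act (inv u) d) = \<rho>" by (simp add: \<rho>)
      then have "d = - \<rho>" using u by (metis act_act_inv act_simps(4) minus_minus)
      then show False using d \<rho>r root_not_pos_and_neg[of \<rho>] by (auto simp: pos_roots_iff)
    qed
    from simple_permutes_pos_roots[OF u(2) dr(2) this] show ?thesis
      using d(1) c u(1) by (simp add: inversion_set_iff inv_p act_simps pos_roots_iff)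
  qed
  show "- act t d \<in> pos_roots - inversion_set p" if d: "d \<in> inversion_set p" "d \<noteq> \<rho>" for d
  proof -
    have dr: "d \<in> pos_roots" "d \<in> roots" "- act (inv p) d \<in> simple_cone"
      using d c by (auto simp: inversion_set_iff pos_roots_iff)
    \<comment> \<open>The positive root that \<open>p\<close> sends to \<open>- d\<close>.\<close>
    define \<delta> where "\<delta> = - act (inv p) d"
    have \<delta>: "\<delta> \<in> pos_roots"
      using dr act_root[of "inv p" d] neg_root c by (auto simp: pos_roots_iff \<delta>_def)
    have p\<delta>: "act p \<delta> = - d" using c by (simp add: \<delta>_def act_simps)
    have \<delta>c: "root_reflection \<delta> \<in> carrier W" using \<delta> root_reflection_carrier by (auto simp: pos_roots_iff)
    \<comment> \<open>If \<open>u\<close> also made \<open>\<delta>\<close> negative, the reflection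
      in \<open>\<delta>\<close> would shorten both \<open>p\<close> and \<open>u\<close>; it
      cancels in \<open>p \<otimes> inv u\<close>, so \<open>t\<close> would be too short.\<close>
    have u\<delta>: "act u \<delta> \<in> simple_cone"
    proof (rule ccontr)
      assume "act u \<delta> \<notin> simple_cone"
      then have "- act u \<delta> \<in> simple_cone"
        using root_pos_or_neg[of "act u \<delta>"] \<delta> act_root u by (auto simp: pos_roots_iff)
      from inverted_root_length(2)[OF u(1) \<delta> this]
      have 1: "len (u \<otimes> root_reflection \<delta>) < len u" .
      have 2: "len (p \<otimes> root_reflection \<delta>) < len p"
        using dr by (intro inverted_root_length c \<delta>) (simp add: p\<delta> pos_roots_iff)
      have "inv (u \<otimes> root_reflection \<delta>) = root_reflection \<delta> \<otimes> inv u"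
        using u \<delta>c \<delta> by (simp add: inv_mult_group root_reflection_inv pos_roots_iff)
      then have "(p \<otimes> root_reflection \<delta>) \<otimes> inv (u \<otimes> root_reflection \<delta>)
          = p \<otimes> (root_reflection \<delta> \<otimes> root_reflection \<delta>) \<otimes> inv u"
        using c \<delta>c u(1) by (simp add: m_assoc)
      also have "\<dots> = t" using \<delta> u(4) c by (simp add: root_reflection_square pos_roots_iff)
      finally have "len t \<le> len (p \<otimes> root_reflection \<delta>) + len (u \<otimes> root_reflection \<delta>)"
        using len_mult_le[of "p \<otimes> root_reflection \<delta>" "inv (u \<otimes> root_reflection \<delta>)"]
          len_inv[of "u \<otimes> root_reflection \<delta>"] c \<delta>c u(1) by simp
      then show False using 1 2 u(6) by linarith
    qed
    have "act t d = act (inv t) d" by (simp only: inv_t)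
    also have "\<dots> = act u (act (inv p) d)"
      unfolding u(4) using u(1) c by (simp add: inv_mult_group act_mult)
    also have "\<dots> = - act u \<delta>" using u(1) by (simp add: \<delta>_def act_simps)
    finally have td: "- act t d = act u \<delta>" by simp
    \<comment> \<open>\<open>inv p\<close> sends \<open>- act t d\<close> to
      \<open>act s \<delta>\<close>, which is positive, so \<open>- act t d\<close> is not an
      inversion.\<close>
    have "act (inv p) (act u \<delta>) = act s \<delta>" using u(1) by (simp add: inv_p)
    moreover have "\<delta> \<noteq> \<alpha> s"
    proof
      assume "\<delta> = \<alpha> s"
      then have "act p \<delta> = - \<rho>" using u c by (simp add: act_mult \<rho> s_neg act_simps)
      then show False using p\<delta> d by simp
    qed
    then have "act s \<delta> \<in> pos_roots" using simple_permutes_pos_roots[OF u(2) \<delta>] by simp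
    ultimately show ?thesis
      using u\<delta> \<delta> act_root[OF u(1)] root_not_pos_and_neg c by (auto simp: td inversion_set_iff pos_roots_iff)
  qed
  show "d \<in> inversion_set p \<or> - act t d \<in> inversion_set p"
    if d: "d \<in> pos_roots" "d \<noteq> \<rho>" "- act t d \<in> simple_cone" for d
  proof -
    have "- act t d \<noteq> \<rho>"
    proof
      assume "- act t d = \<rho>"
      then have "act t (- act t d) = - \<rho>" using act_root_reflection_self[OF \<rho>r(1)] \<rho>r by simp
      then have "- d = - \<rho>"
        using act_root_reflection_twice[OF \<rho>r(1)] \<rho>r c by (simp add: act_simps)
      then show False using d by simp
    qed
    moreover have "- act t d \<in> pos_roots"
      using d act_root c neg_root by (auto simp: pos_roots_iff)
    moreover have "- act (inv u) d \<in> simple_cone \<or> act (inv u) (act t d) \<in> simple_cone"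
      using reflection_inversion_split[of "inv u" s \<rho> d] u \<rho>r d by (simp add: \<rho>)
    ultimately show ?thesis using in_p d u(1) by (auto simp: act_simps)
  qed
qed

end

subsection \<open>Roots of reflection subgroups\<close>

context geometric_representation
begin

lemma act_root_pos_iff:
  assumes "w \<in> carrier W" "\<beta> \<in> roots"
  shows "act w \<beta> \<in> simple_cone \<longleftrightarrow> - act w \<beta> \<notin> simple_cone"
  using root_pos_or_neg root_not_pos_and_neg act_root[OF assms] by blast

definition pos_subgroup_roots :: "'w set \<Rightarrow> 'v set" where
  "pos_subgroup_roots H = subgroup_roots H \<inter> simple_cone"

lemma pos_subgroup_rootsD:
  assumes "c \<in> pos_subgroup_roots H"
  shows "c \<in> pos_roots" "c \<in> roots" "c \<in> simple_cone" "c \<in> subgroup_roots H"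
  using assms by (auto simp: pos_subgroup_roots_def subgroup_roots_def pos_roots_iff)

lemma subgroup_roots_act:
  assumes "subgroup H W" "a \<in> subgroup_roots H" "c \<in> subgroup_roots H"
  shows "act (root_reflection a) c \<in> subgroup_roots H"
proof -
  have r: "a \<in> roots" "c \<in> roots" "root_reflection a \<in> H" "root_reflection c \<in> H"
    using assms by (auto simp: subgroup_roots_def)
  have "root_reflection (act (root_reflection a) c)
      = root_reflection a \<otimes> root_reflection c \<otimes> inv (root_reflection a)"
    using root_reflection_act[OF r(2) root_reflection_carrier[OF r(1)]] .
  also have "\<dots> \<in> H"
    using r(3,4) subgroup.m_closed[OF assms(1)] subgroup.m_inv_closed[OF assms(1)] by simp
  finally show ?thesis
    using act_root[OF root_reflection_carrier[OF r(1)] r(2)] by (simp add: subgroup_roots_def)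
qed

lemma subgroup_roots_neg: "c \<in> subgroup_roots H \<Longrightarrow> - c \<in> subgroup_roots H"
  by (auto simp: subgroup_roots_def neg_root root_reflection_neg)

lemma subgroup_roots_cases:
  "c \<in> subgroup_roots H \<Longrightarrow> c \<in> pos_subgroup_roots H \<or> - c \<in> pos_subgroup_roots H"
  using root_pos_or_neg subgroup_roots_neg by (auto simp: pos_subgroup_roots_def subgroup_roots_def)

section \<open>Canonical roots and depth\<close>

text \<open>The roots of \<open>H\<close> are stable under the reflection in \<open>a\<close>, and
  each has a sign. So having no inversion in \<open>H\<close> besides \<open>a\<close> amounts to
  keeping the other positive roots of \<open>H\<close> positive, as a simple reflection
  does.\<close>

lemma canonical_roots_iff:
  assumes "subgroup H W"
  shows "a \<in> canonical_roots H \<longleftrightarrow> a \<in> pos_subgroup_roots H \<and>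
    (\<forall>c \<in> pos_subgroup_roots H - {a}. act (root_reflection a) c \<in> pos_subgroup_roots H)"
    (is "?L \<longleftrightarrow> ?R")
proof -
  have inv: "c \<in> inversion_set (root_reflection a) \<longleftrightarrow>
      c \<in> pos_roots \<and> - act (root_reflection a) c \<in> simple_cone" if "a \<in> roots" for c
    using that by (simp add: inversion_set_iff root_reflection_carrier root_reflection_inv)
  show ?thesis
  proof
    assume L: ?L
    then have a: "a \<in> pos_subgroup_roots H" "a \<in> roots"
      by (auto simp: canonical_roots_def pos_subgroup_roots_def pos_roots_iff)
    have "act (root_reflection a) c \<in> pos_subgroup_roots H"
      if c: "c \<in> pos_subgroup_roots H" "c \<noteq> a" for c
    proof -
      have "c \<notin> inversion_set (root_reflection a)"
        using L c pos_subgroup_rootsD(4) by (auto simp: canonical_roots_def)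
      then have "- act (root_reflection a) c \<notin> simple_cone"
        using inv a(2) c(1) pos_subgroup_rootsD(1) by blast
      then show ?thesis
        using subgroup_roots_cases[OF subgroup_roots_act[OF assms, of a c]] a c
        by (auto simp: pos_subgroup_roots_def)
    qed
    then show ?R using a by blast
  next
    assume R: ?R
    then have a: "a \<in> pos_subgroup_roots H" "a \<in> roots" "a \<in> pos_roots" "a \<in> simple_cone"
      using pos_subgroup_rootsD by blast+
    have "c = a" if "c \<in> inversion_set (root_reflection a) \<inter> subgroup_roots H" for c
    proof (rule ccontr)
      assume "c \<noteq> a"
      moreover have c: "c \<in> pos_subgroup_roots H" "- act (root_reflection a) c \<in> simple_cone"
        using that inv[OF a(2)] by (auto simp: pos_subgroup_roots_def pos_roots_iff)
      ultimately have "act (root_reflection a) c \<in> pos_subgroup_roots H" using R by blast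
      then show False using c(2) pos_subgroup_rootsD root_not_pos_and_neg by blast
    qed
    moreover have "a \<in> inversion_set (root_reflection a) \<inter> subgroup_roots H"
      using a inv[OF a(2)] pos_subgroup_rootsD(4) by auto
    ultimately show ?L using a(3) by (auto simp: canonical_roots_def)
  qed
qed

text \<open>Every inversion \<open>d \<noteq> c\<close> of \<open>s\<^sub>c\<close> comes with the inversion \<open>- s\<^sub>c d\<close>, and a shortest \<open>w\<close>
  taking \<open>c\<close> to a simple root inverts one of the two.\<close>

lemma not_canonical_inversion:
  assumes "subgroup H W" "c \<in> pos_subgroup_roots H" "c \<notin> canonical_roots H"
    and w: "w \<in> carrier W" "s \<in> S" "act w c = \<alpha> s"
  shows "\<exists>d \<in> pos_subgroup_roots H. - act w d \<in> simple_cone"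
proof -
  have cr: "c \<in> roots" "c \<in> pos_roots" "c \<in> subgroup_roots H" using assms pos_subgroup_rootsD by blast+
  obtain d where d: "d \<in> pos_subgroup_roots H" "d \<noteq> c"
      "act (root_reflection c) d \<notin> pos_subgroup_roots H"
    using assms canonical_roots_iff by blast
  define d' where "d' = - act (root_reflection c) d"
  have dr: "d \<in> roots" "d \<in> pos_roots" "d \<in> subgroup_roots H" using d pos_subgroup_rootsD by blast+
  have d': "d' \<in> pos_subgroup_roots H"
    using subgroup_roots_cases[OF subgroup_roots_act[OF assms(1) cr(3) dr(3)]] d(3) by (simp add: d'_def)
  have "- act w d \<in> simple_cone \<or> - act w d' \<in> simple_cone"
    using reflection_inversion_split[OF w cr(2) dr(2) d(2)] w(1) by (simp add: d'_def act_simps)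
  then show ?thesis using d d' by blast
qed

text \<open>A shortest \<open>w\<close> taking a noncanonical \<open>a\<close> to a simple root
  would invert a root of \<open>H\<close>, which is shallower than \<open>a\<close>.\<close>

lemma min_depth_canonical:
  assumes H: "subgroup H W" and a: "a \<in> pos_subgroup_roots H"
    and min: "\<And>c. c \<in> pos_subgroup_roots H \<Longrightarrow> depth a \<le> depth c"
  shows "a \<in> canonical_roots H"
proof (rule ccontr)
  assume "a \<notin> canonical_roots H"
  obtain w s where w: "w \<in> carrier W" "s \<in> S" "len w = depth a" "act w a = \<alpha> s"
    using depth_attained[OF pos_subgroup_rootsD(2)[OF a]] by blast
  obtain d where d: "d \<in> pos_subgroup_roots H" "- act w d \<in> simple_cone"
    using not_canonical_inversion[OF H a \<open>a \<notin> canonical_roots H\<close> w(1,2,4)] by blast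
  then have "depth d < len w" using inverted_root_length(1) w(1) pos_subgroup_rootsD(1) by blast
  then show False using min[OF d(1)] w by simp
qed

text \<open>\<open>w \<otimes> root_reflection d\<close> takes the reflected root to the same simple
  root and is shorter than \<open>w\<close>.\<close>

lemma inverted_reflection_depth:
  assumes w: "w \<in> carrier W" "s \<in> S" "len w = depth c" "act w c = \<alpha> s"
    and d: "d \<in> pos_roots" "- act w d \<in> simple_cone"
  shows "depth d < depth c" "depth (act (root_reflection d) c) < depth c"
proof -
  have r: "d \<in> roots" "root_reflection d \<in> carrier W"
    using d root_reflection_carrier by (auto simp: pos_roots_iff)
  show "depth d < depth c" using inverted_root_length(1)[OF w(1) d] w by simp
  have "depth (act (root_reflection d) c) \<le> len (w \<otimes> root_reflection d)"
    using w r by (intro depth_le[of _ s]) (auto simp: act_mult)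
  then show "depth (act (root_reflection d) c) < depth c"
    using inverted_root_length(2)[OF w(1) d] w by simp
qed

text \<open>Otherwise the root inverted by a shortest \<open>w\<close> for \<open>b\<close> is
  shallower than \<open>b\<close>, hence is \<open>a\<close>. Then the reflection in
  \<open>a\<close> takes \<open>b\<close> to a shallower positive root other than \<open>a\<close>,
  against the choice of \<open>b\<close>.\<close>

lemma second_min_depth_canonical:
  assumes H: "subgroup H W" and a: "a \<in> canonical_roots H"
    and b: "b \<in> pos_subgroup_roots H - {a}"
    and min: "\<And>c. c \<in> pos_subgroup_roots H - {a} \<Longrightarrow> depth b \<le> depth c"
  shows "b \<in> canonical_roots H"
proof (rule ccontr)
  assume "b \<notin> canonical_roots H"
  obtain w s where w: "w \<in> carrier W" "s \<in> S" "len w = depth b" "act w b = \<alpha> s"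
    using depth_attained[OF pos_subgroup_rootsD(2), of b H] b by blast
  obtain d where d: "d \<in> pos_subgroup_roots H" "- act w d \<in> simple_cone"
    using not_canonical_inversion[OF H _ \<open>b \<notin> canonical_roots H\<close> w(1,2,4)] b by blast
  have *: "depth d < depth b" "depth (act (root_reflection d) b) < depth b"
    using inverted_reflection_depth[OF w _ d(2)] pos_subgroup_rootsD(1)[OF d(1)] by auto
  then have da: "d = a" using min[of d] d(1) by (cases "d = a") auto
  have aP: "a \<in> pos_subgroup_roots H"
    and ab: "act (root_reflection a) b \<in> pos_subgroup_roots H"
    using a b canonical_roots_iff[OF H] by auto
  have "act (root_reflection a) b \<noteq> a"
  proof
    assume ab': "act (root_reflection a) b = a"
    have "b = act (root_reflection a) (act (root_reflection a) b)"
      using pos_subgroup_rootsD(2)[OF aP] by simp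
    also have "\<dots> = - a" unfolding ab' using pos_subgroup_rootsD(2)[OF aP] by simp
    finally have "- a \<in> simple_cone" using b pos_subgroup_rootsD(3)[of b H] by simp
    then show False
      using root_not_pos_and_neg[OF pos_subgroup_rootsD(2,3)[OF aP]] by simp
  qed
  then show False using min[of "act (root_reflection a) b"] *(2) da ab by simp
qed

lemma canonical_pair_exists:
  assumes H: "subgroup H W"
    and "u \<in> pos_subgroup_roots H" "v \<in> pos_subgroup_roots H" "u \<noteq> v"
  shows "\<exists>a b. a \<in> canonical_roots H \<and> b \<in> canonical_roots H \<and> a \<noteq> b"
proof -
  let ?P = "pos_subgroup_roots H"
  obtain a where a: "a \<in> ?P" "\<And>c. c \<in> ?P \<Longrightarrow> depth a \<le> depth c"
    using ex_has_least_nat[of "\<lambda>c. c \<in> ?P" u depth] assms(2) by blast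
  have "\<exists>c. c \<in> ?P - {a}" using assms by blast
  then obtain b where b: "b \<in> ?P - {a}" "\<And>c. c \<in> ?P - {a} \<Longrightarrow> depth b \<le> depth c"
    using ex_has_least_nat[of "\<lambda>c. c \<in> ?P - {a}" _ depth] by blast
  have "a \<in> canonical_roots H" using min_depth_canonical[OF H a] .
  moreover from second_min_depth_canonical[OF H this b] have "b \<in> canonical_roots H" .
  ultimately show ?thesis using b by blast
qed

end

section \<open>Rank two subgroups with two canonical roots\<close>

text \<open>The plane in \<open>planar\<close> is given by arbitrary vectors; that \<open>a\<close>
  and \<open>b\<close> span the roots is derived. The assumptions are symmetric in \<open>a\<close>
  and \<open>b\<close>, so \<open>swap\<close> transfers results between them.\<close>

locale rank_two_subgroup = geometric_representation W S B \<alpha> act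
  for W :: "('w, 'm) monoid_scheme" (structure) and S :: "'w set"
    and B :: "'v::real_vector \<Rightarrow> 'v \<Rightarrow> real" and \<alpha> :: "'w \<Rightarrow> 'v" and act :: "'w \<Rightarrow> 'v \<Rightarrow> 'v" +
  fixes H :: "'w set" and a b :: 'v
  assumes subgroup_H: "subgroup H W"
    and planar: "\<exists>u v. subgroup_roots H \<subseteq> span {u, v}"
    and a_canonical: "a \<in> canonical_roots H"
    and b_canonical: "b \<in> canonical_roots H"
    and a_neq_b: "a \<noteq> b"
begin

abbreviation "P \<equiv> pos_subgroup_roots H"
abbreviation "sa \<equiv> act (root_reflection a)"
abbreviation "sb \<equiv> act (root_reflection b)"

lemma swap: "rank_two_subgroup W S B \<alpha> act H b a"
  using subgroup_H planar a_canonical b_canonical a_neq_b geometric_representation_axioms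
  by (simp add: rank_two_subgroup_def rank_two_subgroup_axioms_def)

lemma a_P: "a \<in> P" and b_P: "b \<in> P"
  using a_canonical b_canonical canonical_roots_iff[OF subgroup_H] by auto

lemma P_roots: "c \<in> P \<Longrightarrow> c \<in> roots" and P_pos: "c \<in> P \<Longrightarrow> c \<in> pos_roots"
  and P_cone: "c \<in> P \<Longrightarrow> c \<in> simple_cone"
  using pos_subgroup_rootsD by blast+

lemma P_neg: "c \<in> P \<Longrightarrow> - c \<notin> simple_cone"
  using P_roots P_cone root_not_pos_and_neg by blast

lemma a_root: "a \<in> roots" and b_root: "b \<in> roots"
  using a_P b_P P_roots by auto

lemma sa_P: "c \<in> P \<Longrightarrow> c \<noteq> a \<Longrightarrow> sa c \<in> P"
  using a_canonical canonical_roots_iff[OF subgroup_H] by auto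

lemma sb_P: "c \<in> P \<Longrightarrow> c \<noteq> b \<Longrightarrow> sb c \<in> P"
  using b_canonical canonical_roots_iff[OF subgroup_H] by auto

lemma refl_carrier: "root_reflection a \<in> carrier W" "root_reflection b \<in> carrier W"
  using a_root b_root root_reflection_carrier by auto

text \<open>If the product were positive, \<open>d\<close> would be a positive combination of
  \<open>c\<close> and the positive root \<open>e\<close>. The reflection in \<open>d\<close> keeps
  both positive but negates \<open>d\<close>.\<close>

lemma canonical_nonpos:
  assumes "c \<in> canonical_roots H" "d \<in> canonical_roots H" "c \<noteq> d"
  shows "B c d \<le> 0"
proof (rule ccontr)
  assume pos: "\<not> ?thesis"
  have P: "c \<in> P" "d \<in> P" using assms canonical_roots_iff[OF subgroup_H] by auto
  note r = P_roots[OF P(1)] P_roots[OF P(2)]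
  define e where "e = act (root_reflection c) d"
  have e: "e = d - (2 * B c d) *\<^sub>R c" using r by (simp add: e_def act_root_reflection)
  have eP: "e \<in> P" using assms P canonical_roots_iff[OF subgroup_H] by (auto simp: e_def)
  have "e \<noteq> d" using e pos r root_nonzero by auto
  then have "act (root_reflection d) e \<in> P" "act (root_reflection d) c \<in> P"
    using assms P eP canonical_roots_iff[OF subgroup_H] by auto
  then have "act (root_reflection d) e + (2 * B c d) *\<^sub>R act (root_reflection d) c \<in> simple_cone"
    using pos by (intro cone_add cone_scale P_cone) auto
  moreover have "act (root_reflection d) e + (2 * B c d) *\<^sub>R act (root_reflection d) c = - d"
    using r root_reflection_carrier[OF r(2)] by (simp add: e act_simps)
  ultimately show False using P_neg[OF P(2)] by simp
qed

lemma combination_zero: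
  assumes "x *\<^sub>R a + y *\<^sub>R b = 0"
  shows "x = 0 \<and> y = 0"
proof (rule ccontr)
  assume nz: "\<not> ?thesis"
  have "x \<noteq> 0" using nz assms root_nonzero[OF b_root] by auto
  have "x *\<^sub>R a = (- y) *\<^sub>R b" using assms by (simp add: eq_neg_iff_add_eq_0)
  then have "(1 / x) *\<^sub>R x *\<^sub>R a = (1 / x) *\<^sub>R (- y) *\<^sub>R b" by (rule arg_cong)
  then have "a = (- y / x) *\<^sub>R b" using \<open>x \<noteq> 0\<close> by simp
  then show False using pos_roots_parallel[OF P_pos[OF a_P] P_pos[OF b_P]] a_neq_b by blast
qed

lemma combination_unique:
  assumes "x *\<^sub>R a + y *\<^sub>R b = x' *\<^sub>R a + y' *\<^sub>R b"
  shows "x = x'" "y = y'"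
  using combination_zero[of "x - x'" "y - y'"] assms by (auto simp: algebra_simps)

text \<open>Since \<open>a\<close> and \<open>b\<close> are not parallel, a third independent root
  would not fit in the plane.\<close>

lemma combination_exists:
  assumes "c \<in> P"
  shows "\<exists>x y. c = x *\<^sub>R a + y *\<^sub>R b"
proof (rule ccontr)
  assume no: "\<not> ?thesis"
  have ab: "independent {a, b}"
  proof -
    have "a \<notin> span {b}"
    proof
      assume "a \<in> span {b}"
      then obtain k where "a = k *\<^sub>R b" by (auto simp: span_singleton)
      then show False using pos_roots_parallel[OF P_pos[OF a_P] P_pos[OF b_P]] a_neq_b by blast
    qed
    then show ?thesis using root_nonzero[OF b_root] by (intro independent_insertI) (auto simp: independent_empty)
  qed
  have "c \<notin> span {a, b}"
  proof
    assume "c \<in> span {a, b}"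
    then obtain k l where "c - k *\<^sub>R a = l *\<^sub>R b"
      by (auto simp: span_insert[of a "{b}"] span_singleton)
    then have "c = k *\<^sub>R a + l *\<^sub>R b" by (simp add: algebra_simps)
    then show False using no by blast
  qed
  then have ind: "independent (insert c {a, b})" using ab by (rule independent_insertI)
  obtain u v where uv: "subgroup_roots H \<subseteq> span {u, v}" using planar by blast
  have "insert c {a, b} \<subseteq> span {u, v}" using uv assms a_P b_P pos_subgroup_rootsD(4) by blast
  then have "card (insert c {a, b}) \<le> card {u, v}"
    using independent_span_bound[OF _ ind] by auto
  moreover have "c \<noteq> a" "c \<noteq> b" using \<open>c \<notin> span {a, b}\<close> by (auto simp: span_base)
  ultimately show False using a_neq_b by (auto simp: card_insert_if split: if_splits)
qed

text \<open>If only \<open>y\<close> is negative, the reflection in \<open>a\<close> exhibits the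
  negative of \<open>x\<close> times \<open>a\<close> as a sum of cone vectors, so \<open>c\<close>
  is parallel to \<open>b\<close>. If \<open>x\<close> is negative too, \<open>- c\<close> is in the
  cone.\<close>

lemma combination_nonneg:
  assumes c: "c \<in> P" "c = x *\<^sub>R a + y *\<^sub>R b"
  shows "0 \<le> y"
proof (rule ccontr)
  assume y: "\<not> ?thesis"
  have ca: "c \<noteq> a" using combination_unique[of 1 0 x y] c y by auto
  show False
  proof (cases "0 \<le> x")
    case True
    have "sa c \<in> simple_cone" using P_cone[OF sa_P[OF c(1) ca]] .
    moreover have "sa b \<in> simple_cone" using P_cone[OF sa_P[OF b_P]] a_neq_b by simp
    ultimately have "sa c + (- y) *\<^sub>R sa b \<in> simple_cone"
      using y by (intro cone_add cone_scale) auto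
    moreover have "sa c + (- y) *\<^sub>R sa b = - (x *\<^sub>R a)"
      using c(2) a_root refl_carrier(1) by (simp add: act_simps)
    moreover have "x *\<^sub>R a \<in> simple_cone" using True a_P P_cone by (intro cone_scale) auto
    ultimately have "x *\<^sub>R a = 0" using cone_pointed by metis
    then have "c = y *\<^sub>R b" using c by simp
    then have "c = b" using pos_roots_parallel[OF P_pos[OF c(1)] P_pos[OF b_P]] by blast
    then show False using combination_unique[of 0 1 x y] c y by auto
  next
    case False
    have "(- x) *\<^sub>R a + (- y) *\<^sub>R b \<in> simple_cone"
      using False y a_P b_P P_cone by (intro cone_add cone_scale) auto
    then show False using P_neg[OF c(1)] c(2) by (simp add: algebra_simps)
  qed
qed

lemma pos_combination:
  assumes "c \<in> P"
  obtains x y where "0 \<le> x" "0 \<le> y" "c = x *\<^sub>R a + y *\<^sub>R b"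
proof -
  interpret swap: rank_two_subgroup W S B \<alpha> act H b a by (rule swap)
  obtain x y where xy: "c = x *\<^sub>R a + y *\<^sub>R b" using combination_exists[OF assms] by blast
  then have "0 \<le> y" "0 \<le> x"
    using combination_nonneg[OF assms xy] swap.combination_nonneg[OF assms, of y x]
    by (auto simp: add.commute)
  then show ?thesis using xy that by blast
qed

text \<open>For a third canonical root, expanding \<open>B c c\<close> along \<open>a\<close> and
  \<open>b\<close> gives at most 0, but roots have norm one.\<close>

lemma canonical_roots_eq: "canonical_roots H = {a, b}"
proof -
  have "c = a \<or> c = b" if c: "c \<in> canonical_roots H" for c
  proof (rule ccontr)
    assume n: "\<not> ?thesis"
    have cP: "c \<in> P" using c canonical_roots_iff[OF subgroup_H] by auto
    obtain x y where xy: "0 \<le> x" "0 \<le> y" "c = x *\<^sub>R a + y *\<^sub>R b" using pos_combination[OF cP] by blast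
    have "B c a \<le> 0" "B c b \<le> 0" using canonical_nonpos c n a_canonical b_canonical by auto
    then have "x * B c a + y * B c b \<le> 0" using xy by (intro add_nonpos_nonpos mult_nonneg_nonpos)
    moreover have "B c c = x * B c a + y * B c b"
      using xy(3) by (metis bilinear_radd[OF B_bilinear] bilinear_rmul[OF B_bilinear] real_scaleR_def)
    ultimately show False using root_norm[OF P_roots[OF cP]] by simp
  qed
  then show ?thesis using a_canonical b_canonical by blast
qed

lemma inverts_generator:
  assumes w: "w \<in> carrier W" and c: "c \<in> P" "- act w c \<in> simple_cone"
  shows "- act w a \<in> simple_cone \<or> - act w b \<in> simple_cone"
proof (rule ccontr)
  assume n: "\<not> ?thesis"
  obtain x y where xy: "0 \<le> x" "0 \<le> y" "c = x *\<^sub>R a + y *\<^sub>R b" using pos_combination[OF c(1)] by blast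
  have "act w a \<in> simple_cone" "act w b \<in> simple_cone"
    using n by (simp_all add: act_root_pos_iff w a_root b_root)
  then have "act w c \<in> simple_cone"
    using xy w by (auto simp: act_simps intro!: cone_add cone_scale)
  then show False using c(2) by (simp add: act_root_pos_iff w P_roots[OF c(1)])
qed

section \<open>Depths of the positive roots of the subgroup\<close>

lemma generator_inverted:
  assumes c: "c \<in> P" "c \<noteq> a" "c \<noteq> b" and w: "w \<in> carrier W" "s \<in> S" "act w c = \<alpha> s"
  shows "- act w a \<in> simple_cone \<or> - act w b \<in> simple_cone"
  using not_canonical_inversion[OF subgroup_H c(1) _ w] canonical_roots_eq c inverts_generator w
  by blast

lemma generator_depth_cases:
  assumes c: "c \<in> P" "c \<noteq> a" "c \<noteq> b"
  shows "depth a < depth c \<and> depth (sa c) < depth c \<or> depth b < depth c \<and> depth (sb c) < depth c"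
proof -
  obtain w s where w: "w \<in> carrier W" "s \<in> S" "len w = depth c" "act w c = \<alpha> s"
    using depth_attained P_roots[OF c(1)] by blast
  show ?thesis
    using generator_inverted[OF c w(1,2,4)] inverted_reflection_depth[OF w] a_P b_P P_pos by blast
qed

lemma refl_eq_iff:
  "sa c = sa d \<longleftrightarrow> c = d" "sb c = sb d \<longleftrightarrow> c = d"
  "sa c = b \<longleftrightarrow> c = sa b" "sb c = a \<longleftrightarrow> c = sb a"
  "sa c = a \<longleftrightarrow> c = - a" "sb c = b \<longleftrightarrow> c = - b"
  using a_root b_root
  by (metis act_root_reflection_twice act_root_reflection_self)+

lemma refl_self: "sa a = - a" "sb b = - b" "- a \<notin> P" "- b \<notin> P"
  using a_root b_root P_neg[OF a_P] P_neg[OF b_P] P_cone by auto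

text \<open>If \<open>c\<close> were no deeper than \<open>a\<close>, the alternative for
  \<open>a\<close> would fail for \<open>c\<close> and for the shallower root \<open>sb c\<close>.
  Reflecting twice in \<open>b\<close> would then return to \<open>c\<close> at a smaller
  depth.\<close>

lemma depth_generator_less:
  assumes c: "c \<in> P" "c \<noteq> a" "c \<noteq> b"
  shows "depth a < depth c"
proof (rule ccontr)
  assume n: "\<not> ?thesis"
  then have 1: "depth (sb c) < depth c" using generator_depth_cases[OF c] by auto
  have 2: "sb c \<in> P" "sb c \<noteq> b" using sb_P c refl_self by (auto simp: refl_eq_iff)
  have "sb c \<noteq> a" using 1 n by auto
  from generator_depth_cases[OF 2(1) this 2(2)] show False
    using 1 n b_root by auto
qed

text \<open>A shortest \<open>w\<close> for \<open>c\<close> inverts \<open>a\<close> or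
  \<open>b\<close>, and reflecting \<open>c\<close> in that root makes it shallower. The induction
  hypothesis applies unless the result is \<open>sa b\<close>, which is immediate, or
  \<open>sb a\<close>, where \<open>w\<close> is shown to invert \<open>sa b\<close>.\<close>

lemma depth_second_less:
  assumes neg: "B a b < 0"
    and c: "c \<in> P" "c \<noteq> a" "c \<noteq> b" "c \<noteq> sa b" "c \<noteq> sb a"
  shows "depth (sa b) < depth c"
  using c
proof (induction "depth c" arbitrary: c rule: less_induct)
  case less
  note c = less.prems
  define f e where "f = sa b" and "e = sb a"
  have fP: "f \<in> P" and eP: "e \<in> P"
    using sa_P[OF b_P] sb_P[OF a_P] a_neq_b by (auto simp: f_def e_def)
  obtain w s where w: "w \<in> carrier W" "s \<in> S" "len w = depth c" "act w c = \<alpha> s"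
    using depth_attained P_roots[OF c(1)] by blast
  note smaller = inverted_reflection_depth[OF w P_pos]
  consider "- act w a \<in> simple_cone" | "- act w b \<in> simple_cone"
    using generator_inverted[OF c(1-3) w(1,2,4)] by blast
  then show ?case
  proof cases
    case 2
    have "depth (sb c) < depth c" using smaller(2)[OF b_P 2] .
    moreover have "sb c \<in> P" "sb c \<noteq> b" "sb c \<noteq> a" "sb c \<noteq> sb a"
      using sb_P c refl_self by (auto simp: refl_eq_iff)
    ultimately show ?thesis using less.hyps[of "sb c"] by (cases "sb c = sa b") auto
  next
    case 1
    have d: "depth (sa c) < depth c" using smaller(2)[OF a_P 1] .
    show ?thesis
    proof (cases "sa c = e")
      case False
      have "sa c \<in> P" "sa c \<noteq> b" "sa c \<noteq> a" "sa c \<noteq> sa b"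
        using sa_P c refl_self by (auto simp: refl_eq_iff)
      then show ?thesis using less.hyps[of "sa c"] d False by (auto simp: e_def)
    next
      case True
      \<comment> \<open>The exceptional root is \<open>c = sa (sb a)\<close>.\<close>
      define k where "k = - B a b"
      have k: "0 < k" using neg by (simp add: k_def)
      have f: "f = b + (2 * k) *\<^sub>R a"
        using a_root by (simp add: f_def act_root_reflection k_def)
      have ef: "e = a + (2 * k) *\<^sub>R b"
        using b_root B_sym[of b a] by (simp add: e_def act_root_reflection k_def)
      have cr: "c \<in> roots" and Pc: "c \<in> pos_roots" using c P_roots P_pos by auto
      have ce: "c = sa e" using True a_root by (metis act_root_reflection_twice)
      have "sa f = b" using a_root by (simp add: f_def)
      then have "B c f = B e b"
        using True B_act[OF refl_carrier(1), of c f] by simp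
      also have "\<dots> = k" by (simp add: ef B_simps root_norm[OF b_root]) (simp add: k_def)
      finally have Bcf: "B c f = k" .
      \<comment> \<open>The partner of \<open>f\<close> under the reflection in \<open>c\<close>. It
        turns out to be \<open>sa (sb f)\<close>, hence positive.\<close>
      define f' where "f' = - act (root_reflection c) f"
      have ka: "(2 * k) *\<^sub>R a = f - b" by (simp add: f)
      have cf: "c = (2 * k) *\<^sub>R f - a"
        using refl_carrier(1) a_root by (simp add: ce ef act_simps f_def)
      have "f' = (2 * k) *\<^sub>R c - f"
        using cr Bcf by (simp add: f'_def act_root_reflection)
      also have "\<dots> = (4 * k * k) *\<^sub>R f - (2 * k) *\<^sub>R a - f"
        by (simp add: cf scaleR_diff_right mult.assoc)
      also have "\<dots> = (4 * k * k - 2) *\<^sub>R f + b"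
        unfolding ka by (simp add: scaleR_diff_left scaleR_2)
      finally have f': "f' = (4 * k * k - 2) *\<^sub>R f + b" .
      have "f \<noteq> e" using ce \<open>sa f = b\<close> c by auto
      have "f \<noteq> b" using f k root_nonzero[OF a_root] by auto
      have "sb f \<in> P" "sb f \<noteq> a"
        using sb_P[OF fP \<open>f \<noteq> b\<close>] \<open>f \<noteq> e\<close> by (auto simp: e_def refl_eq_iff)
      then have "sa (sb f) \<in> P" using sa_P by blast
      moreover have "sa (sb f) = f'"
      proof -
        have "B b f = 1 - 2 * k * k"
          using B_sym[of b a] by (simp add: f B_simps root_norm[OF b_root]) (simp add: k_def)
        then have "sb f = f - (2 * (1 - 2 * k * k)) *\<^sub>R b"
          using b_root by (simp add: act_root_reflection)
        then have "sa (sb f) = b - (2 * (1 - 2 * k * k)) *\<^sub>R f"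
          using refl_carrier(1) \<open>sa f = b\<close> by (simp add: act_simps flip: f_def)
        then show ?thesis by (simp add: f' algebra_simps)
      qed
      ultimately have f'P: "f' \<in> P" by simp
      obtain x y where xy: "0 \<le> x" "f' = x *\<^sub>R a + y *\<^sub>R b" using pos_combination[OF f'P] by blast
      have "x *\<^sub>R a + y *\<^sub>R b = ((4 * k * k - 2) * (2 * k)) *\<^sub>R a + (4 * k * k - 2 + 1) *\<^sub>R b"
        unfolding xy(2)[symmetric] f' f
        by (simp only: scaleR_add_left scaleR_add_right scaleR_scaleR scaleR_one add_ac)
      \<comment> \<open>Comparing coefficients of \<open>a\<close> shows that \<open>f'\<close> is a
        nonnegative combination of \<open>f\<close> and \<open>b\<close>.\<close>
      then have "0 \<le> (4 * k * k - 2) * (2 * k)" using combination_unique(1) xy(1) by metis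
      then have k2: "0 \<le> 4 * k * k - 2" using k by (simp add: zero_le_mult_iff)
      have "- act w f \<in> simple_cone"
      proof (rule ccontr)
        assume nf: "\<not> ?thesis"
        have wf: "act w f \<in> simple_cone" using nf by (simp add: act_root_pos_iff w P_roots fP)
        \<comment> \<open>\<open>w\<close> inverts \<open>a\<close>, so it cannot invert
          \<open>b\<close> too: \<open>c\<close> is a nonnegative combination of them and
          \<open>act w c\<close> is simple.\<close>
        have wb: "act w b \<in> simple_cone"
        proof (rule ccontr)
          assume "\<not> ?thesis"
          then have nb: "- act w b \<in> simple_cone" by (simp add: act_root_pos_iff w b_root)
          obtain x y where xy: "0 \<le> x" "0 \<le> y" "c = x *\<^sub>R a + y *\<^sub>R b"
            using pos_combination[OF c(1)] by blast
          have "\<alpha> s = x *\<^sub>R act w a + y *\<^sub>R act w b"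
            unfolding w(4)[symmetric] xy(3) using w(1) by (simp add: act_simps)
          then have "- \<alpha> s = x *\<^sub>R (- act w a) + y *\<^sub>R (- act w b)" by simp
          also have "\<dots> \<in> simple_cone" using xy 1 nb by (intro cone_add cone_scale)
          finally have "- \<alpha> s \<in> simple_cone" .
          then show False using root_not_pos_and_neg simple_root simple_in_cone w(2) by blast
        qed
        \<comment> \<open>\<open>w\<close> keeps \<open>f\<close> and \<open>b\<close> positive,
          hence also \<open>f'\<close>; but taking \<open>c\<close> to a simple root, it must invert
          \<open>f\<close> or \<open>f'\<close>.\<close>
        have "act w f' \<in> simple_cone"
          unfolding f' using w k2 wf wb by (auto simp: act_simps intro!: cone_add cone_scale)
        moreover have "- act w f' \<in> simple_cone"
          using reflection_inversion_split[OF w(1,2,4) Pc P_pos[OF fP]] nf c w(1)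
          by (auto simp: f'_def act_simps f_def)
        ultimately show False by (simp add: act_root_pos_iff w P_roots f'P)
      qed
      then show ?thesis using smaller(1)[OF fP] by (simp add: f_def)
    qed
  qed
qed

end

section \<open>Prefixes with one inversion in the subgroup\<close>

context geometric_representation
begin

lemma prefix_carrier: "reflection_prefix t p \<Longrightarrow> p \<in> carrier W"
  by (simp add: reflection_prefix_def)

lemma reflection_root_in_pos_subgroup_roots:
  assumes "t \<in> reflections" "t \<in> H"
  shows "reflection_root t \<in> pos_subgroup_roots H"
  using reflection_root_props[OF assms(1)] assms(2)
  by (simp add: pos_subgroup_roots_def subgroup_roots_def pos_roots_iff)

text \<open>If \<open>t\<close> made another positive root \<open>c\<close> of \<open>H\<close>
  negative, the prefix would invert \<open>c\<close> or \<open>- act t c\<close>. The only candidate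
  is the root of \<open>t\<close>, and either way \<open>c\<close> equals it.\<close>

lemma reflection_root_canonical:
  assumes H: "subgroup H W" and t: "t \<in> reflections" "t \<in> H" and p: "reflection_prefix t p"
    and card: "card (inversion_set p \<inter> subgroup_roots H) = 1"
  shows "reflection_root t \<in> canonical_roots H"
proof -
  define \<rho> where "\<rho> = reflection_root t"
  have \<rho>: "\<rho> \<in> pos_subgroup_roots H" "root_reflection \<rho> = t"
    using reflection_root_in_pos_subgroup_roots[OF t] reflection_root_props[OF t(1)]
    by (auto simp: \<rho>_def)
  have "\<rho> \<in> inversion_set p \<inter> subgroup_roots H"
    using prefix_inversions(1)[OF p] pos_subgroup_rootsD(4)[OF \<rho>(1)] by (simp add: \<rho>_def)
  then have I: "inversion_set p \<inter> subgroup_roots H = {\<rho>}"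
    using card by (metis card_1_singletonE singletonD)
  have "act t c \<in> pos_subgroup_roots H" if c: "c \<in> pos_subgroup_roots H" "c \<noteq> \<rho>" for c
  proof (rule ccontr)
    assume n: "act t c \<notin> pos_subgroup_roots H"
    have tc: "act t c \<in> subgroup_roots H"
      using subgroup_roots_act[OF H pos_subgroup_rootsD(4)[OF \<rho>(1)] pos_subgroup_rootsD(4)[OF c(1)]]
      by (simp add: \<rho>)
    then have mtc: "- act t c \<in> pos_subgroup_roots H" using subgroup_roots_cases n by blast
    then have "c \<in> inversion_set p \<or> - act t c \<in> inversion_set p"
      using prefix_inversions(3)[OF p pos_subgroup_rootsD(1)[OF c(1)]] c(2)
        pos_subgroup_rootsD(3) by (auto simp: \<rho>_def)
    then have "- act t c = \<rho>"
      using I c mtc pos_subgroup_rootsD(4) by blast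
    then have "act t (- act t c) = - \<rho>"
      using act_root_reflection_self[OF pos_subgroup_rootsD(2)[OF \<rho>(1)]] \<rho>(2) by simp
    then have "- c = - \<rho>"
      using act_root_reflection_twice[OF pos_subgroup_rootsD(2)[OF \<rho>(1)], of c] \<rho>(2)
        reflections_carrier[OF t(1)] by (simp add: act_simps)
    then show False using c(2) by simp
  qed
  then show ?thesis using canonical_roots_iff[OF H] \<rho> by (auto simp: \<rho>_def)
qed

section \<open>The plane of a dihedral reflection subgroup\<close>

text \<open>A generator moves \<open>v\<close> by a multiple of its root, and the differences
  telescope along a product.\<close>

lemma act_generate_diff_in_span:
  assumes "r \<in> reflections" "t \<in> reflections" "w \<in> generate W {r, t}"
  shows "act w v - v \<in> span {reflection_root r, reflection_root t}"
proof -
  have refl: "act x v - v \<in> span {reflection_root r, reflection_root t}" if "x \<in> {r, t}" for x v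
  proof -
    have "x \<in> reflections" using that assms by blast
    then have "act x v - v = (- (2 * B (reflection_root x) v)) *\<^sub>R reflection_root x"
      using reflection_root_props[of x] act_root_reflection[of "reflection_root x" v]
      by (simp add: pos_roots_iff)
    also have "\<dots> \<in> span {reflection_root r, reflection_root t}"
      using that by (intro span_scale span_base) auto
    finally show ?thesis .
  qed
  show ?thesis
    using assms(3)
  proof (induction arbitrary: v rule: generate.induct)
    case one
    then show ?case by (simp add: span_zero)
  next
    case (incl h)
    then show ?case by (rule refl)
  next
    case (inv h)
    have "inv h = h"
      using inv assms(1,2) root_reflection_inv[of "reflection_root h"] reflection_root_props[of h]
      by (auto simp: pos_roots_iff)
    then show ?case using refl[OF inv] by simp
  next
    case (eng h1 h2)
    have c: "h1 \<in> carrier W" "h2 \<in> carrier W"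
      using eng generate_in_carrier[of "{r, t}"] reflections_carrier assms by auto
    have "act (h1 \<otimes> h2) v - v = (act h1 (act h2 v) - act h2 v) + (act h2 v - v)"
      using c by (simp add: act_mult)
    then show ?case using eng.IH span_add by metis
  qed
qed

text \<open>The reflection in \<open>\<beta>\<close> lies in the subgroup and moves
  \<open>\<beta>\<close> by minus twice itself.\<close>

lemma subgroup_roots_planar:
  assumes "r \<in> reflections" "t \<in> reflections"
  shows "subgroup_roots (generate W {r, t}) \<subseteq> span {reflection_root r, reflection_root t}"
proof
  fix \<beta> assume \<beta>: "\<beta> \<in> subgroup_roots (generate W {r, t})"
  have "- \<beta> - \<beta> \<in> span {reflection_root r, reflection_root t}"
    using \<beta> act_generate_diff_in_span[OF assms, of "root_reflection \<beta>" \<beta>]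
    by (simp add: subgroup_roots_def)
  then have "(-1/2) *\<^sub>R (- \<beta> - \<beta>) \<in> span {reflection_root r, reflection_root t}"
    by (rule span_scale)
  moreover have "(-1/2) *\<^sub>R (- \<beta> - \<beta>) = \<beta>" by (simp add: scaleR_diff_right flip: scaleR_add_left)
  ultimately show "\<beta> \<in> span {reflection_root r, reflection_root t}" by simp
qed

end

section \<open>Prefixes with several inversions in the subgroup\<close>

context rank_two_subgroup
begin

context
  fixes t p and I :: "'v set"
  assumes t: "t \<in> reflections" "t \<in> H" and p: "reflection_prefix t p"
    and I: "I = inversion_set p \<inter> subgroup_roots H" and card_I: "card I > 1"
begin

lemma I_iff: "c \<in> I \<longleftrightarrow> c \<in> P \<and> - act (inv p) c \<in> simple_cone"
  using inversion_set_iff[OF prefix_carrier[OF p], of c]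
  by (auto simp: I pos_subgroup_roots_def pos_roots_iff subgroup_roots_def)

lemma inv_p_carrier: "inv p \<in> carrier W"
  using prefix_carrier[OF p] by simp

lemma not_I: "c \<in> P \<Longrightarrow> c \<notin> I \<Longrightarrow> act (inv p) c \<in> simple_cone"
  using act_root_pos_iff[OF inv_p_carrier] P_roots by (simp add: I_iff)

lemma neg_reflected_I:
  assumes "d \<in> I" "d \<noteq> reflection_root t"
  shows "- act t d \<in> P" "- act t d \<notin> I"
proof -
  have 1: "- act t d \<in> pos_roots" "- act t d \<notin> inversion_set p"
    using prefix_inversions(2)[OF p _ assms(2)] assms(1) I by auto
  have "reflection_root t \<in> subgroup_roots H"
    using reflection_root_in_pos_subgroup_roots[OF t] pos_subgroup_rootsD(4) by blast
  then have "act t d \<in> subgroup_roots H"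
    using subgroup_roots_act[OF subgroup_H, of "reflection_root t" d] reflection_root_props[OF t(1)]
      assms(1) I by auto
  then show "- act t d \<in> P" "- act t d \<notin> I"
    using 1 subgroup_roots_neg by (auto simp: I pos_subgroup_roots_def pos_roots_iff)
qed

text \<open>If neither were inverted, no positive root of \<open>H\<close> would be; if both were,
  all would be. But the partner \<open>- act t d\<close> of an inversion \<open>d\<close> other than
  the root of \<open>t\<close> is not inverted.\<close>

lemma exactly_one_generator: "a \<in> I \<longleftrightarrow> b \<notin> I"
proof -
  have two: "\<exists>d \<in> I. d \<noteq> x" for x
  proof (rule ccontr)
    assume "\<not> ?thesis"
    then have "I \<subseteq> {x}" by blast
    then have "card I \<le> 1" using card_mono[of "{x}" I] by simp
    then show False using card_I by simp
  qed
  obtain d where d: "d \<in> I" "d \<noteq> reflection_root t" using two by blast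
  have "a \<in> I \<or> b \<in> I"
    using inverts_generator[OF inv_p_carrier, of d] d(1) a_P b_P by (auto simp: I_iff)
  moreover have "\<not> (a \<in> I \<and> b \<in> I)"
  proof
    assume ab: "a \<in> I \<and> b \<in> I"
    have d': "- act t d \<in> P" "- act t d \<notin> I" using neg_reflected_I d by auto
    obtain x y where xy: "0 \<le> x" "0 \<le> y" "- act t d = x *\<^sub>R a + y *\<^sub>R b"
      using pos_combination[OF d'(1)] by blast
    have "- act (inv p) (- act t d) = x *\<^sub>R (- act (inv p) a) + y *\<^sub>R (- act (inv p) b)"
      unfolding xy(3) using inv_p_carrier by (simp add: act_simps)
    also have "\<dots> \<in> simple_cone" using xy ab by (intro cone_add cone_scale) (auto simp: I_iff)
    finally show False using d' by (simp add: I_iff)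
  qed
  ultimately show ?thesis by blast
qed

text \<open>The depth comparisons apply once it is known that \<open>b\<close> is not an inversion,
  that \<open>sa b\<close> is one, and that \<open>sb a\<close> is one only if it equals
  \<open>sa b\<close>.\<close>

lemma min_depth_inversions:
  assumes aI: "a \<in> I"
  shows "unique_min_depth I a" "unique_min_depth (I - {a}) (sa b)"
proof -
  have bI: "b \<notin> I" using exactly_one_generator aI by blast
  define q where "q = act (inv p)"
  have qa: "- q a \<in> simple_cone" using aI by (simp add: I_iff q_def)
  have qb: "q b \<in> simple_cone" using not_I[OF b_P bI] by (simp add: q_def)
  have q: "q (x + y) = q x + q y" "q (k *\<^sub>R x) = k *\<^sub>R q x" for x y k
    using inv_p_carrier by (simp_all add: q_def act_simps)
  define k where "k = - 2 * B a b"
  define f e where "f = sa b" and "e = sb a"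
  have f: "f = b + k *\<^sub>R a" using a_root by (simp add: f_def act_root_reflection k_def)
  have e: "e = a + k *\<^sub>R b"
    using b_root B_sym[of b a] by (simp add: e_def act_root_reflection k_def)
  have fP: "f \<in> P" and eP: "e \<in> P"
    using sa_P[OF b_P] sb_P[OF a_P] a_neq_b by (auto simp: f_def e_def)
  have sa_comb: "sa (x *\<^sub>R a + y *\<^sub>R b) = (y * k - x) *\<^sub>R a + y *\<^sub>R b" for x y
    using refl_carrier(1) a_root
    by (simp add: act_simps flip: f_def) (simp add: f algebra_simps)
  have sb_comb: "sb (x *\<^sub>R a + y *\<^sub>R b) = x *\<^sub>R a + (x * k - y) *\<^sub>R b" for x y
    using refl_carrier(2) b_root
    by (simp add: act_simps flip: e_def) (simp add: e algebra_simps)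
  obtain c where c: "c \<in> I" "c \<noteq> a"
  proof (rule ccontr)
    assume "\<not> thesis"
    then have "I \<subseteq> {a}" using that by blast
    then have "card I \<le> 1" using card_mono[of "{a}" I] by simp
    then show False using card_I by simp
  qed
  have cP: "c \<in> P" "c \<noteq> b" using c bI by (auto simp: I_iff)
  obtain x y where xy: "0 \<le> x" "0 \<le> y" "c = x *\<^sub>R a + y *\<^sub>R b" using pos_combination[OF cP(1)] by blast
  have "x \<noteq> 0" using pos_roots_parallel[OF P_pos[OF cP(1)] P_pos[OF b_P]] xy cP by auto
  \<comment> \<open>The quantity is the coefficient of \<open>a\<close> in the positive root
    \<open>sa c\<close>. As \<open>x\<close> is positive, \<open>k\<close> must be too.\<close>
  have ykx: "0 \<le> y * k - x"
  proof -
    obtain x' y' where "0 \<le> x'" "sa c = x' *\<^sub>R a + y' *\<^sub>R b"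
      using pos_combination[OF sa_P[OF cP(1) c(2)]] by blast
    then show ?thesis using combination_unique(1) sa_comb xy(3) by metis
  qed
  then have k: "0 < k" using xy \<open>x \<noteq> 0\<close> by (smt (verit) mult_nonneg_nonpos)
  then have neg: "B a b < 0" by (simp add: k_def)
  \<comment> \<open>Here \<open>c = y f - (y k - x) a\<close>, and \<open>q\<close> makes
    \<open>a\<close> negative; if it kept \<open>f\<close> positive, it would keep \<open>c\<close>
    positive.\<close>
  have fI: "f \<in> I"
  proof (rule ccontr)
    assume "f \<notin> I"
    then have qf: "q f \<in> simple_cone" using not_I fP by (simp add: q_def)
    have "q c = y *\<^sub>R q f + (y * k - x) *\<^sub>R (- q a)" unfolding xy(3) f q by (simp add: algebra_simps)
    also have "\<dots> \<in> simple_cone" using xy ykx qf qa by (intro cone_add cone_scale)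
    finally show False
      using act_root_pos_iff[OF inv_p_carrier P_roots[OF cP(1)]] c(1) by (simp add: q_def I_iff)
  qed
  have fa: "f \<noteq> a" using refl_eq_iff(5)[of b] refl_self(3) b_P by (auto simp: f_def)
  have e_f: "e = f" if eI: "e \<in> I"
  proof (rule ccontr)
    assume ef: "e \<noteq> f"
    have ea: "e \<noteq> a" using e k root_nonzero[OF b_root] by auto
    \<comment> \<open>Here \<open>c = x e - (x k - y) b\<close>, where \<open>x k - y\<close> is the
      coefficient of \<open>b\<close> in \<open>sb c\<close>; so inverting \<open>e\<close> and
      keeping \<open>b\<close> positive inverts \<open>c\<close>.\<close>
    have most: "c \<in> I" if c: "c \<in> P" "c \<noteq> b" for c
    proof -
      obtain x y where xy: "0 \<le> x" "0 \<le> y" "c = x *\<^sub>R a + y *\<^sub>R b" using pos_combination[OF c(1)] by blast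
      obtain x' y' where "0 \<le> y'" "sb c = x' *\<^sub>R a + y' *\<^sub>R b"
        using pos_combination[OF sb_P[OF c]] by blast
      then have "0 \<le> x * k - y" using combination_unique(2) sb_comb xy(3) by metis
      moreover have "- q e \<in> simple_cone" using eI by (simp add: I_iff q_def)
      ultimately have "x *\<^sub>R (- q e) + (x * k - y) *\<^sub>R q b \<in> simple_cone"
        using xy(1) qb by (intro cone_add cone_scale)
      moreover have "- q c = x *\<^sub>R (- q e) + (x * k - y) *\<^sub>R q b"
        unfolding xy(3) e q by (simp add: algebra_simps)
      ultimately have "- q c \<in> simple_cone" by simp
      then show ?thesis using c by (simp add: I_iff q_def)
    qed
    \<comment> \<open>Only \<open>b\<close> is left as a partner. At least two of the distinct
      inversions \<open>a\<close>, \<open>f\<close>, \<open>e\<close> differ from the root of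
      \<open>t\<close>, and they cannot share it.\<close>
    have to_b: "- act t d = b" if "d \<in> I" "d \<noteq> reflection_root t" for d
      using neg_reflected_I[OF that] most by blast
    have t_inj: "d = d'" if "- act t d = - act t d'" for d d'
      using that reflections_carrier[OF t(1)] by (metis act_inv_act neg_equal_iff_equal)
    show False
      using to_b[OF aI] to_b[OF fI] to_b[OF eI] t_inj fa ea ef by metis
  qed
  show "unique_min_depth I a"
    unfolding unique_min_depth_def
  proof (intro conjI ballI)
    fix c assume c: "c \<in> I - {a}"
    then have "c \<noteq> b" using bI by blast
    then show "depth a < depth c" using depth_generator_less[of c] c by (simp add: I_iff)
  qed (rule aI)
  show "unique_min_depth (I - {a}) (sa b)"
    unfolding unique_min_depth_def f_def[symmetric]
  proof (intro conjI ballI)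
    fix c assume c: "c \<in> I - {a} - {f}"
    then have "c \<noteq> e" using e_f by blast
    then show "depth f < depth c"
      using depth_second_less[OF neg, of c] c bI by (auto simp: f_def e_def I_iff)
  qed (use fI fa in auto)
qed

end

end

section \<open>Application to the subgroup generated by two reflections\<close>

context geometric_representation
begin

lemma rank_two_subgroup_generate:
  assumes "r \<in> reflections" "t \<in> reflections"
    and "a \<in> canonical_roots (generate W {r, t})" "b \<in> canonical_roots (generate W {r, t})" "a \<noteq> b"
  shows "rank_two_subgroup W S B \<alpha> act (generate W {r, t}) a b"
  unfolding rank_two_subgroup_def rank_two_subgroup_axioms_def
  using geometric_representation_axioms subgroup_roots_planar[OF assms(1,2)] assms
    generate_is_subgroup[of "{r, t}"] reflections_carrier by auto

text \<open>Two canonical roots come from minimal depth. The one inverted by the prefix is taken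
  first, exchanging the two if necessary.\<close>

lemma canonical_roots_prefix:
  assumes rt: "r \<in> reflections" "t \<in> reflections" "r \<noteq> t" and H: "H = generate W {r, t}"
    and x: "x \<in> {r, t}" and p: "reflection_prefix x p"
    and I: "I = inversion_set p \<inter> subgroup_roots H" and card: "card I > 1"
  shows "\<exists>a b. canonical_roots H = {a, b} \<and> unique_min_depth I a \<and>
    unique_min_depth (I - {a}) (act (root_reflection a) b)"
proof -
  have xH: "x \<in> H" "x \<in> reflections" using rt x by (auto simp: H generate.incl)
  obtain a b where rank: "rank_two_subgroup W S B \<alpha> act H a b"
  proof -
    have "reflection_root r \<in> pos_subgroup_roots H" "reflection_root t \<in> pos_subgroup_roots H"
      using rt by (auto simp: H generate.incl intro!: reflection_root_in_pos_subgroup_roots)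
    moreover have "reflection_root r \<noteq> reflection_root t" using reflection_root_props rt by metis
    moreover have "subgroup H W"
      unfolding H using generate_is_subgroup rt reflections_carrier by simp
    ultimately obtain a b where "a \<in> canonical_roots H" "b \<in> canonical_roots H" "a \<noteq> b"
      using canonical_pair_exists by blast
    then show thesis using rank_two_subgroup_generate[OF rt(1,2)] that unfolding H by blast
  qed
  interpret rank_two_subgroup W S B \<alpha> act H a b by (rule rank)
  interpret swap: rank_two_subgroup W S B \<alpha> act H b a by (rule swap)
  show ?thesis
  proof (cases "a \<in> I")
    case True
    then show ?thesis
      using min_depth_inversions[OF xH(2,1) p I card] canonical_roots_eq by blast
  next
    case False
    then have "b \<in> I" using exactly_one_generator[OF xH(2,1) p I card] by blast
    then show ?thesis
      using swap.min_depth_inversions[OF xH(2,1) p I card] swap.canonical_roots_eq by blast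
  qed
qed

end

theorem theorem3p19:
  fixes W :: "('w, 'm) monoid_scheme" and S :: "'w set"
    and B :: "'v::real_vector \<Rightarrow> 'v \<Rightarrow> real"
    and \<alpha> :: "'w \<Rightarrow> 'v" and act :: "'w \<Rightarrow> 'v \<Rightarrow> 'v"
    and r t p\<^sub>r p\<^sub>t :: 'w and W' :: "'w set" and I\<^sub>r I\<^sub>t :: "'v set"
  assumes "geometric_representation W S B \<alpha> act"
    and "r \<in> coxeter_system.reflections W S" and "t \<in> coxeter_system.reflections W S"
    and "r \<noteq> t"
    and "W' = generate W {r, t}"
    and "coxeter_system.reflection_prefix W S r p\<^sub>r"
    and "coxeter_system.reflection_prefix W S t p\<^sub>t"
    and "I\<^sub>r = geometric_representation.inversion_set W S \<alpha> act p\<^sub>r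
               \<inter> geometric_representation.subgroup_roots W S B \<alpha> act W'"
    and "I\<^sub>t = geometric_representation.inversion_set W S \<alpha> act p\<^sub>t
               \<inter> geometric_representation.subgroup_roots W S B \<alpha> act W'"
  shows
    "(card I\<^sub>r = 1 \<and> card I\<^sub>t = 1 \<longrightarrow>
        geometric_representation.canonical_roots W S B \<alpha> act W' =
          {geometric_representation.reflection_root W S B \<alpha> act r,
           geometric_representation.reflection_root W S B \<alpha> act t} \<and>
        geometric_representation.canonical_generators W S B \<alpha> act W' = {r, t}) \<and>
     (\<forall>I \<in> {I\<^sub>r, I\<^sub>t}. card I > 1 \<longrightarrow>
        (\<exists>\<alpha>\<^sub>1 \<alpha>\<^sub>2 s\<^sub>1 s\<^sub>2.
           s\<^sub>1 = geometric_representation.root_reflection W S B act \<alpha>\<^sub>1 \<and>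
           s\<^sub>2 = geometric_representation.root_reflection W S B act \<alpha>\<^sub>2 \<and>
           geometric_representation.canonical_roots W S B \<alpha> act W' = {\<alpha>\<^sub>1, \<alpha>\<^sub>2} \<and>
           geometric_representation.canonical_generators W S B \<alpha> act W' = {s\<^sub>1, s\<^sub>2} \<and>
           geometric_representation.unique_min_depth W S \<alpha> act I \<alpha>\<^sub>1 \<and>
           geometric_representation.unique_min_depth W S \<alpha> act (I - {\<alpha>\<^sub>1}) (act s\<^sub>1 \<alpha>\<^sub>2)))"
proof -
  interpret geometric_representation W S B \<alpha> act by (rule assms(1))
  note rt = assms(2-4) and W' = assms(5)
  have subgroup: "subgroup W' W"
    unfolding W' using generate_is_subgroup rt reflections_carrier by simp
  have mem: "r \<in> W'" "t \<in> W'" by (auto simp: W' generate.incl)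
  have first: "canonical_roots W' = {reflection_root r, reflection_root t} \<and>
      canonical_generators W' = {r, t}" if "card I\<^sub>r = 1" "card I\<^sub>t = 1"
  proof -
    have can: "reflection_root r \<in> canonical_roots W'" "reflection_root t \<in> canonical_roots W'"
      using reflection_root_canonical[OF subgroup rt(1) mem(1) assms(6)]
        reflection_root_canonical[OF subgroup rt(2) mem(2) assms(7)] that assms(8,9) by auto
    have ne: "reflection_root r \<noteq> reflection_root t"
      using reflection_root_props rt by metis
    \<comment> \<open>Two distinct canonical roots in a plane are already all of them.\<close>
    have "rank_two_subgroup W S B \<alpha> act W' (reflection_root r) (reflection_root t)"
      using rank_two_subgroup_generate[OF rt(1,2)] can ne by (simp add: W')
    then have "canonical_roots W' = {reflection_root r, reflection_root t}"
      by (rule rank_two_subgroup.canonical_roots_eq)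
    then show ?thesis
      using reflection_root_props rt by (simp add: canonical_generators_def)
  qed
  have second: "\<exists>\<alpha>\<^sub>1 \<alpha>\<^sub>2 s\<^sub>1 s\<^sub>2. s\<^sub>1 = root_reflection \<alpha>\<^sub>1 \<and> s\<^sub>2 = root_reflection \<alpha>\<^sub>2 \<and>
      canonical_roots W' = {\<alpha>\<^sub>1, \<alpha>\<^sub>2} \<and> canonical_generators W' = {s\<^sub>1, s\<^sub>2} \<and>
      unique_min_depth I \<alpha>\<^sub>1 \<and> unique_min_depth (I - {\<alpha>\<^sub>1}) (act s\<^sub>1 \<alpha>\<^sub>2)"
    if I: "I \<in> {I\<^sub>r, I\<^sub>t}" "card I > 1" for I
  proof -
    obtain x p where "x \<in> {r, t}" "reflection_prefix x p" "I = inversion_set p \<inter> subgroup_roots W'"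
      using I(1) assms(6-9) by blast
    from canonical_roots_prefix[OF rt W' this I(2)]
    obtain a b where ab: "canonical_roots W' = {a, b}" "unique_min_depth I a"
        "unique_min_depth (I - {a}) (act (root_reflection a) b)" by blast
    then have "canonical_generators W' = {root_reflection a, root_reflection b}"
      by (simp add: canonical_generators_def)
    then show ?thesis using ab by blast
  qed
  show ?thesis using first second by blast
qed

end
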